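(* There exist absolute constants $0<c_1\le c_2$ such that for every $n\ge 1$, every Boolean function $f:\mathrm{Dom}(f)\to\{0,1\}$ with $\mathrm{Dom}(f)\subseteq\{0,1\}^n$ (partial or total), and every $X\in\mathrm{Dom}(f)$, $$c_1\sqrt{RC^X(f)}\;\le\; QC^X(f)\;\le\; c_2\sqrt{RC^X(f)},$$ i.e. $QC^X(f)=\Theta\left(\sqrt{RC^X(f)}\right)$.
   Context: Query model: the input $Y=y_1\ldots y_n\in\mathrm{Dom}(f)$ is accessed only through queries to the bits $y_i$ (classically, or by the standard unitary query oracle in the quantum case); only queries are counted. $f$ is total if $\mathrm{Dom}(f)=\{0,1\}^n$, and partial otherwise. A randomized verifier for an input $X\in\mathrm{Dom}(f)$ is a (possibly adaptive) randomized query algorithm that, on input $Y\in\mathrm{Dom}(f)$, (i) accepts with probability $1$ if $Y=X$, and (ii) rejects with probability at least $1/2$ if $f(Y)\neq f(X)$; if $Y\ne X$ but $f(Y)=f(X)$ the acceptance probability can be arbitrary. The algorithm may depend on $X$ and $f$. $RC^X(f)$ is the minimum, over randomized verifiers for $X$, of the expected number of queries used (worst case over $Y\in\mathrm{Dom}(f)$). $QC^X(f)$ is defined analogously with quantum query algorithms: the minimum number of queries made by a quantum query algorithm satisfying (i) and (ii). *)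

theory Defs
  imports
    "HOL-Probability.Probability_Mass_Function"
    "Jordan_Normal_Form.Schur_Decomposition"
begin

text \<open>
  An input is a bit string, given as a \<^typ>\<open>bool list\<close> of length \<open>n\<close> whose bits are indexed from 0.
  A possibly partial Boolean function is a map \<open>f :: bool list \<rightharpoonup> bool\<close>; on \<^term>\<open>dom f\<close> the options
  \<open>f Y\<close> and \<open>f X\<close> differ exactly when the Boolean values differ.
  HOL-Analysis also has types and constants named \<open>vec\<close> and \<open>mat\<close>; hence the qualified names below.
\<close>

section \<open>Randomized query algorithms\<close>

datatype dtree = Leaf bool | Query nat dtree dtree

fun wf_dtree :: "nat \<Rightarrow> dtree \<Rightarrow> bool" where
  "wf_dtree n (Leaf a) = True"
| "wf_dtree n (Query i t0 t1) = (i < n \<and> wf_dtree n t0 \<and> wf_dtree n t1)"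

fun accepts :: "dtree \<Rightarrow> bool list \<Rightarrow> bool" where
  "accepts (Leaf a) Y = a"
| "accepts (Query i t0 t1) Y = accepts (if Y ! i then t1 else t0) Y"

fun queries :: "dtree \<Rightarrow> bool list \<Rightarrow> nat" where
  "queries (Leaf a) Y = 0"
| "queries (Query i t0 t1) Y = Suc (queries (if Y ! i then t1 else t0) Y)"

text \<open>
  An adaptive randomized query algorithm is a probability distribution on deterministic decision
  trees. The depth of the trees need not be bounded, so the expected number of queries may be
  infinite; it is therefore an \<^typ>\<open>ennreal\<close>.
\<close>

definition randomized_verifier ::
    "nat \<Rightarrow> (bool list \<rightharpoonup> bool) \<Rightarrow> bool list \<Rightarrow> dtree pmf \<Rightarrow> bool" where
  "randomized_verifier n f X p \<longleftrightarrow>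
     (\<forall>t\<in>set_pmf p. wf_dtree n t) \<and>
     measure_pmf.prob p {t. accepts t X} = 1 \<and>
     (\<forall>Y\<in>dom f. f Y \<noteq> f X \<longrightarrow> measure_pmf.prob p {t. \<not> accepts t Y} \<ge> 1 / 2)"

definition expected_queries :: "dtree pmf \<Rightarrow> bool list \<Rightarrow> ennreal" where
  "expected_queries p Y = (\<integral>\<^sup>+ t. of_nat (queries t Y) \<partial>measure_pmf p)"

text \<open>
  The infimum is finite by the lemma \<open>RC_finite\<close> below, so that \<^const>\<open>enn2real\<close> does not collapse
  an infinite value to 0.
\<close>

definition RC :: "nat \<Rightarrow> (bool list \<rightharpoonup> bool) \<Rightarrow> bool list \<Rightarrow> real" where
  "RC n f X = enn2real (INF p \<in> {p. randomized_verifier n f X p}. SUP Y \<in> dom f. expected_queries p Y)"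


section \<open>Quantum query algorithms\<close>

definition unitary_mat :: "nat \<Rightarrow> complex Matrix.mat \<Rightarrow> bool" where
  "unitary_mat d U \<longleftrightarrow> U \<in> carrier_mat d d \<and> mat_adjoint U * U = 1\<^sub>m d"

text \<open>
  The computational basis consists of the states \<open>|i, b, z\<rangle>\<close> with a query index \<open>i < n\<close>, an answer
  bit \<open>b < 2\<close> and a workspace content \<open>z < w\<close>; the state \<open>|i, b, z\<rangle>\<close> is the basis vector number
  \<open>(2 * i + b) * w + z\<close> of a space of dimension \<open>n * 2 * w\<close>. The query unitary maps
  \<open>|i, b, z\<rangle>\<close> to \<open>|i, b XOR y\<^sub>i, z\<rangle>\<close>.
\<close>

definition basis_index :: "nat \<Rightarrow> nat \<Rightarrow> nat \<Rightarrow> nat \<Rightarrow> nat" where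
  "basis_index w i b z = (2 * i + b) * w + z"

definition query_perm :: "nat \<Rightarrow> bool list \<Rightarrow> nat \<Rightarrow> nat" where
  "query_perm w Y k =
     (let i = k div (2 * w); b = k div w mod 2; z = k mod w
      in basis_index w i (if Y ! i then 1 - b else b) z)"

definition query_mat :: "nat \<Rightarrow> nat \<Rightarrow> bool list \<Rightarrow> complex Matrix.mat" where
  "query_mat n w Y =
     Matrix.mat (n * 2 * w) (n * 2 * w) (\<lambda>(r, c). if r = query_perm w Y c then 1 else 0)"

text \<open>
  A quantum algorithm applies \<open>U\<^sub>0\<close> to the first basis vector, then alternates queries with the
  input-independent unitaries \<open>U\<^sub>1, \<dots>, U\<^sub>T\<close>, making \<open>T\<close> queries, and finally measures in the
  computational basis; it accepts if the outcome lies in the accepting set.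
\<close>

record quantum_alg =
  workspace :: nat
  first_unitary :: "complex Matrix.mat"
  later_unitaries :: "complex Matrix.mat list"
  accepting :: "nat set"

definition wf_quantum_alg :: "nat \<Rightarrow> quantum_alg \<Rightarrow> bool" where
  "wf_quantum_alg n Q \<longleftrightarrow>
     workspace Q > 0 \<and>
     (\<forall>U \<in> set (first_unitary Q # later_unitaries Q). unitary_mat (n * 2 * workspace Q) U) \<and>
     accepting Q \<subseteq> {..<n * 2 * workspace Q}"

definition quantum_queries :: "quantum_alg \<Rightarrow> nat" where
  "quantum_queries Q = length (later_unitaries Q)"

definition final_state :: "nat \<Rightarrow> quantum_alg \<Rightarrow> bool list \<Rightarrow> complex Matrix.vec" where
  "final_state n Q Y =
     foldl (\<lambda>\<psi> U. U *\<^sub>v (query_mat n (workspace Q) Y *\<^sub>v \<psi>))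
       (first_unitary Q *\<^sub>v unit_vec (n * 2 * workspace Q) 0) (later_unitaries Q)"

definition accept_prob :: "nat \<Rightarrow> quantum_alg \<Rightarrow> bool list \<Rightarrow> real" where
  "accept_prob n Q Y = (\<Sum>k\<in>accepting Q. (cmod (vec_index (final_state n Q Y) k))\<^sup>2)"

definition quantum_verifier ::
    "nat \<Rightarrow> (bool list \<rightharpoonup> bool) \<Rightarrow> bool list \<Rightarrow> quantum_alg \<Rightarrow> bool" where
  "quantum_verifier n f X Q \<longleftrightarrow>
     wf_quantum_alg n Q \<and>
     accept_prob n Q X = 1 \<and>
     (\<forall>Y\<in>dom f. f Y \<noteq> f X \<longrightarrow> 1 - accept_prob n Q Y \<ge> 1 / 2)"

definition QC :: "nat \<Rightarrow> (bool list \<rightharpoonup> bool) \<Rightarrow> bool list \<Rightarrow> nat" where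
  "QC n f X = (LEAST T. \<exists>Q. quantum_verifier n f X Q \<and> quantum_queries Q = T)"


section \<open>Finiteness of the randomized complexity\<close>

text \<open>The deterministic algorithm that compares the input with \<open>X\<close> bit by bit, from bit \<open>i\<close> on:\<close>

fun compare_tree :: "nat \<Rightarrow> bool list \<Rightarrow> dtree" where
  "compare_tree i [] = Leaf True"
| "compare_tree i (x # xs) =
     (let t = compare_tree (Suc i) xs
      in if x then Query i (Leaf False) t else Query i t (Leaf False))"

lemma wf_compare_tree: "i + length xs \<le> n \<Longrightarrow> wf_dtree n (compare_tree i xs)"
  by (induction i xs rule: compare_tree.induct) (auto simp: Let_def)

lemma accepts_compare_tree:
  "accepts (compare_tree i xs) Y \<longleftrightarrow> (\<forall>j < length xs. Y ! (i + j) = xs ! j)"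
  by (induction i xs rule: compare_tree.induct) (auto simp: Let_def All_less_Suc2)

lemma queries_compare_tree: "queries (compare_tree i xs) Y \<le> length xs"
  by (induction i xs rule: compare_tree.induct) (auto simp: Let_def)

lemma randomized_verifier_compare_tree:
  assumes "dom f \<subseteq> {Y. length Y = n}" and "X \<in> dom f"
  shows "randomized_verifier n f X (return_pmf (compare_tree 0 X))"
proof -
  have len: "length X = n" using assms by auto
  have "\<not> accepts (compare_tree 0 X) Y" if "Y \<in> dom f" "f Y \<noteq> f X" for Y
  proof -
    have "length Y = n" "Y \<noteq> X" using that assms by auto
    with len show ?thesis by (auto simp: accepts_compare_tree list_eq_iff_nth_eq)
  qed
  then show ?thesis
    using len by (auto simp: randomized_verifier_def wf_compare_tree accepts_compare_tree
        measure_return indicator_def)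
qed

lemma RC_finite:
  assumes "dom f \<subseteq> {Y. length Y = n}" and "X \<in> dom f"
  shows "(INF p \<in> {p. randomized_verifier n f X p}. SUP Y \<in> dom f. expected_queries p Y) < \<infinity>"
proof -
  let ?p = "return_pmf (compare_tree 0 X)"
  have "length X = n" using assms by auto
  then have "expected_queries ?p Y \<le> of_nat n" for Y
    using queries_compare_tree[of 0 X Y] by (simp add: expected_queries_def of_nat_mono)
  then have "(SUP Y \<in> dom f. expected_queries ?p Y) \<le> of_nat n"
    by (rule SUP_least)
  moreover have "(INF p \<in> {p. randomized_verifier n f X p}. SUP Y \<in> dom f. expected_queries p Y)
      \<le> (SUP Y \<in> dom f. expected_queries ?p Y)"
    using randomized_verifier_compare_tree[OF assms] by (intro INF_lower) simp
  ultimately show ?thesis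
    using of_nat_less_top[of n] by (metis order.trans order.strict_trans1 infinity_ennreal_def)
qed

end

theory Submission
  imports Defs
begin

text \<open>
  Both complexities are governed by the same quantity: the largest \<open>\<delta>\<close> such that some distribution
  on the bit positions hits the difference set of \<open>X\<close> and \<open>Y\<close> with probability at least \<open>\<delta>\<close> for
  every \<open>Y\<close> with \<open>f Y \<noteq> f X\<close>.

  A quantum verifier with \<open>T\<close> queries yields such a distribution with \<open>\<delta> = \<Omega>(1 / T\<^sup>2)\<close>, namely its
  average query weight on input \<open>X\<close>, by the hybrid argument; sampling \<open>O(1 / \<delta>)\<close> positions is a
  randomized verifier. Conversely a randomized verifier with \<open>R\<close> expected queries yields
  \<open>\<delta> \<ge> 1 / (2 R)\<close>: to reject \<open>Y\<close> it must query a difference on the path that \<open>X\<close> follows. Given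
  the distribution, a uniform superposition over the number of Grover iterations, tested against the
  initial state, is a quantum verifier with \<open>O(1 / sqrt \<delta>)\<close> queries and perfect completeness.
\<close>

section \<open>Unitaries and queries\<close>

lemma basis_index_simps [simp]:
  assumes "b < 2" "z < w"
  shows "basis_index w i b z div (2 * w) = i" "basis_index w i b z div w mod 2 = b"
    "basis_index w i b z mod w = z"
proof -
  have d: "basis_index w i b z div w = 2 * i + b"
    using assms by (simp add: basis_index_def)
  show "basis_index w i b z div (2 * w) = i"
    using d assms by (simp add: mult.commute[of 2 w] div_mult2_eq)
  show "basis_index w i b z div w mod 2 = b"
    using d assms by simp
  show "basis_index w i b z mod w = z"
    using assms by (simp add: basis_index_def)
qed

lemma basis_index_less:
  assumes "i < n" "b < 2" "z < w"
  shows "basis_index w i b z < n * 2 * w"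
proof -
  have "(2 * i + b) * w + z < (2 * i + b + 1) * w" using assms by simp
  also have "\<dots> \<le> (n * 2) * w" using assms by (intro mult_right_mono) auto
  finally show ?thesis by (simp add: basis_index_def)
qed

lemma basis_index_cases:
  assumes "k < n * 2 * w"
  obtains i b z where "i < n" "b < 2" "z < w" "k = basis_index w i b z"
proof
  have w: "w > 0" using assms by (cases w) auto
  show "k div (2 * w) < n" using assms w
    by (simp add: less_mult_imp_div_less mult.assoc)
  show "k div w mod 2 < 2" by simp
  show "k mod w < w" using w by simp
  have "2 * (k div (2 * w)) + k div w mod 2 = k div w"
    by (simp add: mult.commute[of 2 w] div_mult2_eq)
  then show "k = basis_index w (k div (2 * w)) (k div w mod 2) (k mod w)"
    by (simp add: basis_index_def)
qed

lemma sum_basis_index: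
  fixes F :: "nat \<Rightarrow> 'a::comm_monoid_add"
  shows "(\<Sum>k<n * 2 * w. F k) = (\<Sum>i<n. \<Sum>b<2. \<Sum>z<w. F (basis_index w i b z))"
proof -
  have "(\<Sum>k<n * 2 * w. F k) = (\<Sum>i<n. \<Sum>k = i * (2 * w)..<i * (2 * w) + 2 * w. F k)"
    using sum.nat_group[of F "2 * w" n] by (simp add: mult.assoc)
  also have "\<dots> = (\<Sum>i<n. \<Sum>b<2. \<Sum>z<w. F (basis_index w i b z))"
  proof (rule sum.cong[OF refl])
    fix i
    have "(\<Sum>k = i * (2 * w)..<i * (2 * w) + 2 * w. F k) = (\<Sum>k<2 * w. F (i * (2 * w) + k))"
      using sum.shift_bounds_nat_ivl[of F 0 "i * (2 * w)" "2 * w"]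
      by (simp add: add.commute atLeast0LessThan)
    also have "\<dots> = (\<Sum>b<2. \<Sum>k = b * w..<b * w + w. F (i * (2 * w) + k))"
      by (rule sum.nat_group[symmetric])
    also have "\<dots> = (\<Sum>b<2. \<Sum>z<w. F (i * (2 * w) + (b * w + z)))"
    proof (rule sum.cong[OF refl])
      fix b
      show "(\<Sum>k = b * w..<b * w + w. F (i * (2 * w) + k)) = (\<Sum>z<w. F (i * (2 * w) + (b * w + z)))"
        using sum.shift_bounds_nat_ivl[of "\<lambda>k. F (i * (2 * w) + k)" 0 "b * w" w]
        by (simp add: add.commute atLeast0LessThan)
    qed
    finally show "(\<Sum>k = i * (2 * w)..<i * (2 * w) + 2 * w. F k)
      = (\<Sum>b<2. \<Sum>z<w. F (basis_index w i b z))"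
      by (simp add: basis_index_def algebra_simps)
  qed
  finally show ?thesis .
qed

lemma query_perm_basis_index:
  assumes "b < 2" "z < w"
  shows "query_perm w Y (basis_index w i b z) = basis_index w i (if Y ! i then 1 - b else b) z"
  using assms unfolding query_perm_def Let_def by simp

lemma query_perm_less:
  assumes "k < n * 2 * w" shows "query_perm w Y k < n * 2 * w"
  using assms
  by (elim basis_index_cases) (auto simp: query_perm_basis_index intro!: basis_index_less)

lemma query_perm_query_perm:
  assumes "k < n * 2 * w" shows "query_perm w Y (query_perm w Y k) = k"
  using assms
  by (elim basis_index_cases) (auto simp: query_perm_basis_index less_2_cases_iff)

lemma query_perm_div:
  assumes "k < n * 2 * w" shows "query_perm w Y k div (2 * w) = k div (2 * w)"
  using assms
  by (elim basis_index_cases) (auto simp: query_perm_basis_index)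

lemma query_perm_cong:
  assumes "k < n * 2 * w" "Y ! (k div (2 * w)) = X ! (k div (2 * w))"
  shows "query_perm w Y k = query_perm w X k"
  using assms by (simp add: query_perm_def)

lemma bij_betw_query_perm:
  "bij_betw (query_perm w Y) {..<n * 2 * w} {..<n * 2 * w}"
  by (rule bij_betw_byWitness[where f' = "query_perm w Y"])
     (auto simp: query_perm_query_perm query_perm_less)

text \<open>The query permutation is an involution, so it serves as its own inverse when columns are
  turned into rows.\<close>

lemma query_mat_mult_vec:
  assumes v: "v \<in> carrier_vec (n * 2 * w)"
  shows "query_mat n w Y *\<^sub>v v = Matrix.vec (n * 2 * w) (\<lambda>r. vec_index v (query_perm w Y r))"
    (is "?l = ?r")
proof (rule eq_vecI)
  fix r assume "r < dim_vec ?r"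
  then have r: "r < n * 2 * w" by simp
  have "vec_index ?l r = (\<Sum>c<n * 2 * w. (if r = query_perm w Y c then 1 else 0) * vec_index v c)"
    using r v by (simp add: query_mat_def scalar_prod_def atLeast0LessThan)
  also have "\<dots> = (\<Sum>c<n * 2 * w. if c = query_perm w Y r then vec_index v c else 0)"
    using r by (intro sum.cong) (auto simp: query_perm_query_perm)
  also have "\<dots> = vec_index v (query_perm w Y r)"
    using r by (simp add: query_perm_less)
  finally show "vec_index ?l r = vec_index ?r r" using r by simp
qed (simp add: query_mat_def)

section \<open>Unitary matrices and the Euclidean norm\<close>

lemma mat_adjoint_index:
  fixes U :: "complex Matrix.mat"
  assumes "U \<in> carrier_mat d d"
  shows "mat_adjoint U \<in> carrier_mat d d"
    "r < d \<Longrightarrow> c < d \<Longrightarrow> mat_adjoint U $$ (r, c) = cnj (U $$ (c, r))"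
  using assms by (auto simp: mat_adjoint_def mat_of_rows_def)

text \<open>Orthonormality of the columns is the entrywise form in which every matrix constructed
  below is checked.\<close>

lemma unitary_matI:
  assumes U: "U \<in> carrier_mat d d"
    and *: "\<And>r c. r < d \<Longrightarrow> c < d \<Longrightarrow> (\<Sum>k<d. cnj (U $$ (k, r)) * U $$ (k, c)) = of_bool (r = c)"
  shows "unitary_mat d U"
  unfolding unitary_mat_def
proof (intro conjI U eq_matI)
  fix r c assume "r < dim_row (1\<^sub>m d)" "c < dim_col (1\<^sub>m d)"
  then have rc: "r < d" "c < d" by auto
  have "(mat_adjoint U * U) $$ (r, c) = (\<Sum>k<d. mat_adjoint U $$ (r, k) * U $$ (k, c))"
    using rc U mat_adjoint_index(1)[OF U] by (simp add: scalar_prod_def atLeast0LessThan)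
  also have "\<dots> = (\<Sum>k<d. cnj (U $$ (k, r)) * U $$ (k, c))"
    using rc by (intro sum.cong) (auto simp: mat_adjoint_index(2)[OF U])
  finally show "(mat_adjoint U * U) $$ (r, c) = 1\<^sub>m d $$ (r, c)"
    using *[OF rc] rc by simp
qed (use U mat_adjoint_index(1)[OF U] in auto)

lemma unitary_matD:
  assumes "unitary_mat d U" "r < d" "c < d"
  shows "(\<Sum>k<d. cnj (U $$ (k, r)) * U $$ (k, c)) = of_bool (r = c)"
proof -
  have U: "U \<in> carrier_mat d d" and e: "mat_adjoint U * U = 1\<^sub>m d"
    using assms by (auto simp: unitary_mat_def)
  have "of_bool (r = c) = (mat_adjoint U * U) $$ (r, c)"
    using assms e by simp
  also have "\<dots> = (\<Sum>k<d. mat_adjoint U $$ (r, k) * U $$ (k, c))"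
    using assms U mat_adjoint_index(1)[OF U] by (simp add: scalar_prod_def atLeast0LessThan)
  also have "\<dots> = (\<Sum>k<d. cnj (U $$ (k, r)) * U $$ (k, c))"
    using assms by (intro sum.cong) (auto simp: mat_adjoint_index(2)[OF U])
  finally show ?thesis ..
qed

text \<open>Expressed by \<open>L2_set\<close> to inherit its triangle inequality and
  monotonicity.\<close>

definition vnorm :: "complex Matrix.vec \<Rightarrow> real" where
  "vnorm v = L2_set (\<lambda>k. cmod (vec_index v k)) {..<dim_vec v}"

lemma cmod_sq_conv: "complex_of_real ((cmod z)\<^sup>2) = cnj z * z"
  by (metis complex_norm_square mult.commute)

lemma unitary_sum_cmod:
  assumes U: "unitary_mat d U" and v: "v \<in> carrier_vec d"
  shows "(\<Sum>k<d. (cmod (vec_index (U *\<^sub>v v) k))\<^sup>2) = (\<Sum>k<d. (cmod (vec_index v k))\<^sup>2)"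
proof -
  let ?v = "vec_index v"
  have Uc: "U \<in> carrier_mat d d" using U by (simp add: unitary_mat_def)
  \<comment> \<open>In the complex numbers every squared modulus is a product
    \<open>cnj z * z\<close>. After expanding both factors, summing over \<open>k\<close> first lets
    the orthonormality of the columns collapse the triple sum.\<close>
  have "complex_of_real (\<Sum>k<d. (cmod (vec_index (U *\<^sub>v v) k))\<^sup>2)
     = (\<Sum>k<d. cnj (\<Sum>r<d. U $$ (k, r) * ?v r) * (\<Sum>c<d. U $$ (k, c) * ?v c))"
    unfolding of_real_sum cmod_sq_conv using Uc v
    by (intro sum.cong) (auto simp: scalar_prod_def atLeast0LessThan)
  also have "\<dots> = (\<Sum>k<d. \<Sum>r<d. \<Sum>c<d. (cnj (?v r) * ?v c) * (cnj (U $$ (k, r)) * U $$ (k, c)))"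
    unfolding cnj_sum sum_product by (intro sum.cong refl) simp
  also have "\<dots> = (\<Sum>r<d. \<Sum>c<d. \<Sum>k<d. (cnj (?v r) * ?v c) * (cnj (U $$ (k, r)) * U $$ (k, c)))"
    by (subst sum.swap) (intro sum.cong refl sum.swap)
  also have "\<dots> = (\<Sum>r<d. \<Sum>c<d. (cnj (?v r) * ?v c) * of_bool (r = c))"
    by (intro sum.cong refl) (simp add: unitary_matD[OF U] flip: sum_distrib_left)
  also have "\<dots> = (\<Sum>r<d. \<Sum>c<d. if c = r then cnj (?v r) * ?v r else 0)"
    by (intro sum.cong refl) auto
  also have "\<dots> = complex_of_real (\<Sum>k<d. (cmod (?v k))\<^sup>2)"
    unfolding of_real_sum cmod_sq_conv by simp
  finally show ?thesis using of_real_eq_iff by blast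
qed

lemma unitary_mat_carrier: "unitary_mat d U \<Longrightarrow> U \<in> carrier_mat d d"
  by (simp add: unitary_mat_def)

lemma vnorm_unitary:
  assumes U: "unitary_mat d U" and v: "v \<in> carrier_vec d"
  shows "vnorm (U *\<^sub>v v) = vnorm v"
  using unitary_sum_cmod[OF assms] unitary_mat_carrier[OF U] v by (simp add: vnorm_def L2_set_def)

lemma unitary_mat_mult:
  assumes A: "unitary_mat d A" and B: "unitary_mat d B"
  shows "unitary_mat d (A * B)"
proof (rule unitary_matI)
  have Ac: "A \<in> carrier_mat d d" and Bc: "B \<in> carrier_mat d d"
    using A B by (auto simp: unitary_mat_def)
  then show "A * B \<in> carrier_mat d d" by simp
  fix r c assume rc: "r < d" "c < d"
  have "(\<Sum>k<d. cnj ((A * B) $$ (k, r)) * (A * B) $$ (k, c))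
    = (\<Sum>k<d. (\<Sum>i<d. cnj (A $$ (k, i)) * cnj (B $$ (i, r))) * (\<Sum>j<d. A $$ (k, j) * B $$ (j, c)))"
    using Ac Bc rc by (intro sum.cong) (auto simp: scalar_prod_def atLeast0LessThan)
  also have "\<dots> = (\<Sum>k<d. \<Sum>i<d. \<Sum>j<d. (cnj (B $$ (i, r)) * B $$ (j, c)) * (cnj (A $$ (k, i)) * A $$ (k, j)))"
    unfolding sum_product by (intro sum.cong refl) simp
  also have "\<dots> = (\<Sum>i<d. \<Sum>j<d. \<Sum>k<d. (cnj (B $$ (i, r)) * B $$ (j, c)) * (cnj (A $$ (k, i)) * A $$ (k, j)))"
    by (subst sum.swap) (intro sum.cong refl sum.swap)
  also have "\<dots> = (\<Sum>i<d. \<Sum>j<d. (cnj (B $$ (i, r)) * B $$ (j, c)) * of_bool (i = j))"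
    by (intro sum.cong refl) (simp add: unitary_matD[OF A] flip: sum_distrib_left)
  also have "\<dots> = (\<Sum>i<d. \<Sum>j<d. if j = i then cnj (B $$ (i, r)) * B $$ (i, c) else 0)"
    by (intro sum.cong refl) auto
  also have "\<dots> = of_bool (r = c)" using unitary_matD[OF B rc] by simp
  finally show "(\<Sum>k<d. cnj ((A * B) $$ (k, r)) * (A * B) $$ (k, c)) = of_bool (r = c)" .
qed

section \<open>From quantum to randomized verifiers\<close>

text \<open>The norm of the projection of \<open>v\<close> onto the basis states whose query index
  lies in \<open>S\<close>; its square is the query weight of \<open>S\<close>.\<close>

definition block_norm :: "nat \<Rightarrow> nat set \<Rightarrow> complex Matrix.vec \<Rightarrow> real" where
  "block_norm w S v =
     L2_set (\<lambda>k. of_bool (k div (2 * w) \<in> S) * cmod (vec_index v k)) {..<dim_vec v}"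

lemma block_norm_power2:
  "(block_norm w S v)\<^sup>2 = (\<Sum>k<dim_vec v. of_bool (k div (2 * w) \<in> S) * (cmod (vec_index v k))\<^sup>2)"
proof -
  have "(of_bool b * x)\<^sup>2 = of_bool b * x\<^sup>2" for b and x :: real by (cases b) auto
  then show ?thesis by (simp add: block_norm_def L2_set_def sum_nonneg)
qed

lemma sum_block_norm_power2:
  assumes "finite S"
  shows "(\<Sum>i\<in>S. (block_norm w {i} v)\<^sup>2) = (block_norm w S v)\<^sup>2"
  unfolding block_norm_power2
proof (subst sum.swap, rule sum.cong[OF refl])
  fix k
  have "(\<Sum>i\<in>S. of_bool (k div (2 * w) \<in> {i}) * (cmod (vec_index v k))\<^sup>2)
      = (\<Sum>i\<in>S. if k div (2 * w) = i then (cmod (vec_index v k))\<^sup>2 else 0)"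
    by (intro sum.cong) auto
  then show "(\<Sum>i\<in>S. of_bool (k div (2 * w) \<in> {i}) * (cmod (vec_index v k))\<^sup>2)
      = of_bool (k div (2 * w) \<in> S) * (cmod (vec_index v k))\<^sup>2"
    using assms by simp
qed

text \<open>Difference sets such as \<open>{i. Y ! i \<noteq> X ! i}\<close> may contain indices
  from \<open>n\<close> on, where \<open>!\<close> is unspecified; no basis state carries such a
  query index.\<close>

lemma block_norm_full:
  assumes "v \<in> carrier_vec (n * 2 * w)"
  shows "block_norm w (S \<inter> {..<n}) v = block_norm w S v" "block_norm w {..<n} v = vnorm v"
proof -
  have "k div (2 * w) < n" if "k < n * 2 * w" for k
    using that by (elim basis_index_cases) simp
  then show "block_norm w (S \<inter> {..<n}) v = block_norm w S v" "block_norm w {..<n} v = vnorm v"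
    using assms by (auto simp: block_norm_def vnorm_def intro!: L2_set_cong)
qed

lemma L2_set_query_perm:
  "L2_set (\<lambda>k. F (query_perm w Y k)) {..<n * 2 * w} = L2_set F {..<n * 2 * w}"
  unfolding L2_set_def
  using sum.reindex_bij_betw[OF bij_betw_query_perm, of "\<lambda>k. (F k)\<^sup>2" w Y n] by simp

lemma vnorm_query_mat:
  assumes "v \<in> carrier_vec (n * 2 * w)"
  shows "vnorm (query_mat n w Y *\<^sub>v v) = vnorm v"
proof -
  have "vnorm (query_mat n w Y *\<^sub>v v) = L2_set (\<lambda>k. cmod (vec_index v (query_perm w Y k))) {..<n * 2 * w}"
    using assms by (auto simp: query_mat_mult_vec vnorm_def intro!: L2_set_cong)
  then show ?thesis using assms L2_set_query_perm[of "\<lambda>k. cmod (vec_index v k)"] by (simp add: vnorm_def)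
qed

text \<open>Split the difference as \<open>Q\<^sub>Y (u - v) + (Q\<^sub>Y - Q\<^sub>X) v\<close>.
  The first term has the norm of \<open>u - v\<close>. The two queries agree outside the blocks of
  differing bits, and inside these each contributes at most the block norm of \<open>v\<close>,
  hence the factor 2.\<close>

lemma query_difference:
  assumes u: "u \<in> carrier_vec (n * 2 * w)" and v: "v \<in> carrier_vec (n * 2 * w)"
  shows "vnorm (query_mat n w Y *\<^sub>v u - query_mat n w X *\<^sub>v v)
    \<le> vnorm (u - v) + 2 * block_norm w {i. Y ! i \<noteq> X ! i} v"
proof -
  let ?N = "n * 2 * w" and ?D = "{i. Y ! i \<noteq> X ! i}"
  let ?b = "\<lambda>Z k. of_bool (query_perm w Z k div (2 * w) \<in> ?D) * cmod (vec_index v (query_perm w Z k))"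
  let ?d = "\<lambda>k. cmod (vec_index (u - v) (query_perm w Y k))"
  have "cmod (vec_index (query_mat n w Y *\<^sub>v u - query_mat n w X *\<^sub>v v) k)
      \<le> ?d k + (?b Y k + ?b X k)" if k: "k < ?N" for k
  proof -
    have "cmod (vec_index (query_mat n w Y *\<^sub>v u - query_mat n w X *\<^sub>v v) k)
        = cmod (vec_index (u - v) (query_perm w Y k)
             + (vec_index v (query_perm w Y k) - vec_index v (query_perm w X k)))"
      using k u v by (simp add: query_mat_mult_vec query_perm_less)
    also have "\<dots> \<le> ?d k + cmod (vec_index v (query_perm w Y k) - vec_index v (query_perm w X k))"
      by (rule norm_triangle_ineq)
    also have "cmod (vec_index v (query_perm w Y k) - vec_index v (query_perm w X k)) \<le> ?b Y k + ?b X k"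
    proof (cases "Y ! (k div (2 * w)) = X ! (k div (2 * w))")
      case True
      then show ?thesis using query_perm_cong[OF k True] by simp
    next
      case False
      then show ?thesis using norm_triangle_ineq4 by (simp add: query_perm_div[OF k])
    qed
    finally show ?thesis by simp
  qed
  then have "vnorm (query_mat n w Y *\<^sub>v u - query_mat n w X *\<^sub>v v)
      \<le> L2_set (\<lambda>k. ?d k + (?b Y k + ?b X k)) {..<?N}"
    unfolding vnorm_def using v by (subst index_minus_vec(2)) (auto simp: query_mat_mult_vec intro: L2_set_mono)
  also have "\<dots> \<le> L2_set ?d {..<?N} + (L2_set (?b Y) {..<?N} + L2_set (?b X) {..<?N})"
    by (rule order.trans[OF L2_set_triangle_ineq add_left_mono[OF L2_set_triangle_ineq]])
  also have "L2_set ?d {..<?N} = vnorm (u - v)"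
    using L2_set_query_perm[of "\<lambda>k. cmod (vec_index (u - v) k)"] u v by (simp add: vnorm_def)
  also have "L2_set (?b Y) {..<?N} = block_norm w ?D v"
    using L2_set_query_perm[of "\<lambda>k. of_bool (k div (2 * w) \<in> ?D) * cmod (vec_index v k)"] v
    by (simp add: block_norm_def)
  also have "L2_set (?b X) {..<?N} = block_norm w ?D v"
    using L2_set_query_perm[of "\<lambda>k. of_bool (k div (2 * w) \<in> ?D) * cmod (vec_index v k)"] v
    by (simp add: block_norm_def)
  finally show ?thesis by simp
qed

text \<open>\<open>final_state\<close> with free start vector and list of unitaries, so that
  prefixes of an algorithm are runs too and an induction can peel off the last unitary.\<close>

definition run :: "nat \<Rightarrow> nat \<Rightarrow> bool list \<Rightarrow> complex Matrix.vec \<Rightarrow> complex Matrix.mat list \<Rightarrow> complex Matrix.vec" where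
  "run n w Y \<phi> Us = foldl (\<lambda>\<psi> U. U *\<^sub>v (query_mat n w Y *\<^sub>v \<psi>)) \<phi> Us"

lemma run_simps [simp]:
  "run n w Y \<phi> [] = \<phi>"
  "run n w Y \<phi> (Us @ [U]) = U *\<^sub>v (query_mat n w Y *\<^sub>v run n w Y \<phi> Us)"
  by (simp_all add: run_def)

lemma run_unitary:
  assumes "\<phi> \<in> carrier_vec (n * 2 * w)" "\<forall>U\<in>set Us. unitary_mat (n * 2 * w) U"
  shows "run n w Y \<phi> Us \<in> carrier_vec (n * 2 * w) \<and> vnorm (run n w Y \<phi> Us) = vnorm \<phi>"
  using assms(2)
proof (induction Us rule: rev_induct)
  case (snoc U Us)
  then have IH: "run n w Y \<phi> Us \<in> carrier_vec (n * 2 * w)" "vnorm (run n w Y \<phi> Us) = vnorm \<phi>"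
    and U: "unitary_mat (n * 2 * w) U" by auto
  have c: "query_mat n w Y *\<^sub>v run n w Y \<phi> Us \<in> carrier_vec (n * 2 * w)"
    using IH by (simp add: query_mat_mult_vec)
  with U IH show ?case
    by (auto simp: vnorm_unitary vnorm_query_mat intro: mult_mat_vec_carrier unitary_mat_carrier)
qed (use assms in auto)

text \<open>The hybrid argument of Bennett, Bernstein, Brassard and Vazirani.\<close>

lemma run_difference:
  assumes \<phi>: "\<phi> \<in> carrier_vec (n * 2 * w)" and Us: "\<forall>U\<in>set Us. unitary_mat (n * 2 * w) U"
  shows "vnorm (run n w Y \<phi> Us - run n w X \<phi> Us)
    \<le> 2 * (\<Sum>t<length Us. block_norm w {i. Y ! i \<noteq> X ! i} (run n w X \<phi> (take t Us)))"
  using Us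
proof (induction Us rule: rev_induct)
  case Nil
  have "\<phi> - \<phi> = 0\<^sub>v (n * 2 * w)" using \<phi> by auto
  then show ?case by (simp add: vnorm_def L2_set_def)
next
  case (snoc U Us)
  let ?a = "run n w Y \<phi> Us" and ?b = "run n w X \<phi> Us" and ?N = "n * 2 * w"
  let ?D = "{i. Y ! i \<noteq> X ! i}"
  have U: "unitary_mat ?N U" and Us: "\<forall>U\<in>set Us. unitary_mat ?N U" using snoc.prems by auto
  have a: "?a \<in> carrier_vec ?N" and b: "?b \<in> carrier_vec ?N"
    using run_unitary[OF \<phi> Us] by auto
  have qa: "query_mat n w Y *\<^sub>v ?a \<in> carrier_vec ?N" and qb: "query_mat n w X *\<^sub>v ?b \<in> carrier_vec ?N"
    using a b by (auto simp: query_mat_mult_vec)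
  have "run n w Y \<phi> (Us @ [U]) - run n w X \<phi> (Us @ [U])
      = U *\<^sub>v (query_mat n w Y *\<^sub>v ?a - query_mat n w X *\<^sub>v ?b)"
    using mult_minus_distrib_mat_vec[OF unitary_mat_carrier[OF U] qa qb] by simp
  then have "vnorm (run n w Y \<phi> (Us @ [U]) - run n w X \<phi> (Us @ [U]))
      = vnorm (query_mat n w Y *\<^sub>v ?a - query_mat n w X *\<^sub>v ?b)"
    using vnorm_unitary[OF U] qa qb by (simp del: run_simps)
  also have "\<dots> \<le> vnorm (?a - ?b) + 2 * block_norm w ?D ?b"
    by (rule query_difference[OF a b])
  also have "vnorm (?a - ?b) \<le> 2 * (\<Sum>t<length Us. block_norm w ?D (run n w X \<phi> (take t Us)))"
    by (rule snoc.IH[OF Us])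
  finally show ?case by simp
qed

lemma final_state_run:
  "final_state n Q Y =
     run n (workspace Q) Y (first_unitary Q *\<^sub>v unit_vec (n * 2 * workspace Q) 0) (later_unitaries Q)"
  by (simp add: final_state_def run_def)

lemma wf_quantum_algD:
  assumes wf: "wf_quantum_alg n Q" and n: "n \<ge> 1"
  defines "\<phi> \<equiv> first_unitary Q *\<^sub>v unit_vec (n * 2 * workspace Q) 0"
  shows "\<phi> \<in> carrier_vec (n * 2 * workspace Q)" "vnorm \<phi> = 1"
    "\<forall>U\<in>set (later_unitaries Q). unitary_mat (n * 2 * workspace Q) U"
proof -
  let ?N = "n * 2 * workspace Q"
  have N: "?N > 0" and U: "unitary_mat ?N (first_unitary Q)"
    using wf n by (auto simp: wf_quantum_alg_def)
  show "\<phi> \<in> carrier_vec ?N"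
    using unitary_mat_carrier[OF U] by (auto simp: \<phi>_def intro: mult_mat_vec_carrier)
  have "vnorm (unit_vec ?N 0) = sqrt (\<Sum>k<?N. if k = 0 then 1 else 0)"
    unfolding vnorm_def L2_set_def
    by (intro arg_cong[of _ _ sqrt] sum.cong) (auto simp: unit_vec_def)
  also have "\<dots> = 1" using N by simp
  finally show "vnorm \<phi> = 1" by (simp add: \<phi>_def vnorm_unitary[OF U])
  show "\<forall>U\<in>set (later_unitaries Q). unitary_mat ?N U"
    using wf by (auto simp: wf_quantum_alg_def)
qed

text \<open>On the accepting set the final state for \<open>X\<close> has norm 1 and that for
  \<open>Y\<close> at most \<open>sqrt (1 / 2)\<close>, which is below 3/4; the triangle inequality
  leaves 1/4 for the difference.\<close>

lemma accept_prob_difference: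
  assumes "wf_quantum_alg n Q" "n \<ge> 1" "accept_prob n Q X = 1" "accept_prob n Q Y \<le> 1 / 2"
  shows "1 / 4 \<le> vnorm (final_state n Q Y - final_state n Q X)"
proof -
  let ?N = "n * 2 * workspace Q" and ?A = "accepting Q"
  let ?x = "final_state n Q X" and ?y = "final_state n Q Y"
  have A: "?A \<subseteq> {..<?N}" using assms by (simp add: wf_quantum_alg_def)
  then have fin: "finite ?A" using finite_subset by blast
  have c: "?x \<in> carrier_vec ?N" "?y \<in> carrier_vec ?N"
    using run_unitary wf_quantum_algD[OF assms(1,2)] by (auto simp: final_state_run)
  let ?L = "\<lambda>v. L2_set (\<lambda>k. cmod (vec_index v k)) ?A"
  have "?L ?x \<le> L2_set (\<lambda>k. cmod (vec_index ?y k) + cmod (vec_index (?y - ?x) k)) ?A"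
  proof (rule L2_set_mono)
    fix k assume "k \<in> ?A"
    then have "k < ?N" using A by auto
    then have "vec_index ?x k = vec_index ?y k - vec_index (?y - ?x) k" using c by simp
    then show "cmod (vec_index ?x k) \<le> cmod (vec_index ?y k) + cmod (vec_index (?y - ?x) k)"
      using norm_triangle_ineq4[of "vec_index ?y k" "vec_index (?y - ?x) k"] by simp
  qed simp
  also have "\<dots> \<le> ?L ?y + ?L (?y - ?x)" by (rule L2_set_triangle_ineq)
  also have "?L (?y - ?x) \<le> vnorm (?y - ?x)"
    unfolding vnorm_def L2_set_def using c A by (intro real_sqrt_le_mono sum_mono2) auto
  also have "?L ?x = 1" using assms(3) by (simp add: L2_set_def accept_prob_def)
  also have "?L ?y \<le> sqrt (1 / 2)"
    using assms(4) unfolding L2_set_def accept_prob_def by (rule real_sqrt_le_mono)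
  also have "sqrt (1 / 2) \<le> (3 / 4 :: real)"
    by (rule real_le_lsqrt) (auto simp: power2_eq_square)
  finally show ?thesis by simp
qed

section \<open>From query weights to a sampling verifier\<close>

lemma prob_Collect_not:
  "measure_pmf.prob p {x. \<not> P x} = 1 - measure_pmf.prob p {x. P x}"
proof -
  have "{x. \<not> P x} = space (measure_pmf p) - {x. P x}" by auto
  then show ?thesis using measure_pmf.prob_compl[of "{x. P x}" p] by simp
qed

lemma pmf_on_initial_segment:
  fixes q :: "nat \<Rightarrow> real"
  assumes "\<And>i. q i \<ge> 0" "(\<Sum>i<n. q i) = 1"
  obtains p where "\<And>S. measure_pmf.prob p S = (\<Sum>i\<in>S \<inter> {..<n}. q i)" "set_pmf p \<subseteq> {..<n}"
proof -
  let ?f = "\<lambda>i. if i < n then q i else 0"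
  have "(\<integral>\<^sup>+x. ennreal (?f x) \<partial>count_space UNIV) = (\<Sum>i<n. ennreal (?f i))"
    by (rule nn_integral_count_space'[where A="{..<n}"]) auto
  also have "\<dots> = ennreal (\<Sum>i<n. q i)"
    using assms by (subst sum_ennreal[symmetric]) auto
  finally have int: "(\<integral>\<^sup>+x. ennreal (?f x) \<partial>count_space UNIV) = 1" using assms by simp
  have nn: "?f i \<ge> 0" for i using assms by simp
  let ?p = "embed_pmf ?f"
  have set: "set_pmf ?p \<subseteq> {..<n}"
    by (auto simp: set_embed_pmf[OF nn int] split: if_splits)
  have "measure_pmf.prob ?p S = (\<Sum>i\<in>S \<inter> {..<n}. q i)" for S
  proof -
    have "measure_pmf.prob ?p S = measure_pmf.prob ?p (S \<inter> {..<n})"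
      using set by (intro measure_pmf.finite_measure_eq_AE) (auto simp: AE_measure_pmf_iff)
    then show ?thesis by (simp add: measure_measure_pmf_finite pmf_embed_pmf[OF nn int])
  qed
  with set that show ?thesis by blast
qed

text \<open>\<open>p\<close> is the outcome of measuring the query index on input \<open>X\<close>
  before a uniformly random query. The hybrid argument bounds the summed block norms of the
  difference set by 1/8 from below; Cauchy-Schwarz over the \<open>T\<close> queries passes to their
  squares, whence the 64 and the square of \<open>T\<close>.\<close>

lemma quantum_verifier_query_distribution:
  assumes ver: "quantum_verifier n f X Q" and n: "n \<ge> 1" and T: "quantum_queries Q > 0"
  obtains p where "set_pmf p \<subseteq> {..<n}"
    "\<And>Y. Y \<in> dom f \<Longrightarrow> f Y \<noteq> f X \<Longrightarrow>
       measure_pmf.prob p {i. Y ! i \<noteq> X ! i} \<ge> 1 / (64 * (quantum_queries Q)\<^sup>2)"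
proof -
  have wf: "wf_quantum_alg n Q" using ver by (simp add: quantum_verifier_def)
  define w where "w = workspace Q"
  define \<phi> where "\<phi> = first_unitary Q *\<^sub>v unit_vec (n * 2 * w) 0"
  define Us where "Us = later_unitaries Q"
  define T where "T = length Us"
  define \<psi> where "\<psi> t = run n w X \<phi> (take t Us)" for t
  have T0: "T > 0" and TQ: "quantum_queries Q = T"
    using T by (auto simp: T_def Us_def quantum_queries_def)
  note wfD = wf_quantum_algD[OF wf n, folded w_def, folded \<phi>_def Us_def]
  have \<psi>: "\<psi> t \<in> carrier_vec (n * 2 * w)" "vnorm (\<psi> t) = 1" for t
    using run_unitary[OF wfD(1), of "take t Us" X] wfD by (auto simp: \<psi>_def dest: in_set_takeD)
  define q where "q i = (\<Sum>t<T. (block_norm w {i} (\<psi> t))\<^sup>2) / T" for i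
  have q0: "q i \<ge> 0" for i by (simp add: q_def sum_nonneg)
  have q_sum: "(\<Sum>i\<in>S \<inter> {..<n}. q i) = (\<Sum>t<T. (block_norm w S (\<psi> t))\<^sup>2) / T" for S
    unfolding q_def sum_divide_distrib[symmetric]
    by (subst sum.swap) (simp add: sum_block_norm_power2 block_norm_full(1)[OF \<psi>(1)])
  have "(\<Sum>i<n. q i) = 1"
    using q_sum[of "{..<n}"] T0 by (simp add: block_norm_full(2)[OF \<psi>(1)] \<psi>(2))
  from pmf_on_initial_segment[OF q0 this] obtain p where
    p: "\<And>S. measure_pmf.prob p S = (\<Sum>i\<in>S \<inter> {..<n}. q i)" "set_pmf p \<subseteq> {..<n}" by blast
  show ?thesis
  proof (rule that[OF p(2)])
    fix Y assume Y: "Y \<in> dom f" "f Y \<noteq> f X"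
    let ?D = "{i. Y ! i \<noteq> X ! i}"
    have "accept_prob n Q X = 1" "accept_prob n Q Y \<le> 1 / 2"
      using ver Y by (auto simp: quantum_verifier_def)
    from accept_prob_difference[OF wf n this]
    have "1 / 4 \<le> vnorm (run n w Y \<phi> Us - run n w X \<phi> Us)"
      by (simp add: final_state_run w_def \<phi>_def Us_def)
    also have "\<dots> \<le> 2 * (\<Sum>t<T. block_norm w ?D (\<psi> t))"
      using run_difference[OF wfD(1,3)] by (simp add: T_def \<psi>_def)
    finally have "1 / 8 \<le> (\<Sum>t<T. block_norm w ?D (\<psi> t))" by simp
    then have "(1 / 8)\<^sup>2 \<le> (\<Sum>t<T. block_norm w ?D (\<psi> t))\<^sup>2"
      by (intro power_mono) auto
    also have "\<dots> \<le> (\<Sum>t<T. (block_norm w ?D (\<psi> t))\<^sup>2) * T"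
      using sum_squared_le_sum_of_squares[of "\<lambda>t. block_norm w ?D (\<psi> t)" "{..<T}"] by simp
    also have "\<dots> = measure_pmf.prob p ?D * T\<^sup>2"
      using T0 by (simp add: p q_sum power2_eq_square)
    finally show "measure_pmf.prob p ?D \<ge> 1 / (64 * (quantum_queries Q)\<^sup>2)"
      using T0 by (simp add: TQ field_simps)
  qed
qed

primrec check_tree :: "bool list \<Rightarrow> nat list \<Rightarrow> dtree" where
  "check_tree X [] = Leaf True"
| "check_tree X (i # js) =
     (if X ! i then Query i (Leaf False) (check_tree X js) else Query i (check_tree X js) (Leaf False))"

lemma wf_check_tree: "set js \<subseteq> {..<n} \<Longrightarrow> wf_dtree n (check_tree X js)"
  by (induction js) auto

lemma accepts_check_tree: "accepts (check_tree X js) Y \<longleftrightarrow> (\<forall>i\<in>set js. Y ! i = X ! i)"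
  by (induction js) auto

lemma queries_check_tree: "queries (check_tree X js) Y \<le> length js"
  by (induction js) auto

text \<open>Independence of the samples; the induction integrates over the first one, which is why
  \<open>emeasure\<close> comes before \<open>prob\<close>.\<close>

lemma emeasure_replicate_pmf_lists:
  "emeasure (replicate_pmf k q) (lists S) = emeasure (measure_pmf q) S ^ k"
proof (induction k)
  case (Suc k)
  have "(\<integral>\<^sup>+xs. indicator (lists S) (x # xs) \<partial>measure_pmf (replicate_pmf k q))
      = indicator S x * emeasure (measure_pmf q) S ^ k" for x
  proof (cases "x \<in> S")
    case True
    then have "(\<lambda>xs. indicator (lists S) (x # xs) :: ennreal) = indicator (lists S)"
      by (auto simp: indicator_def fun_eq_iff)
    then show ?thesis using True Suc.IH by simp
  qed (simp add: indicator_def)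
  then show ?case by (simp add: nn_integral_multc)
qed simp

lemma prob_replicate_pmf_lists:
  "measure_pmf.prob (replicate_pmf k q) (lists S) = measure_pmf.prob q S ^ k"
  using emeasure_replicate_pmf_lists[of k q S]
  by (simp add: measure_pmf.emeasure_eq_measure ennreal_power)

lemma RC_le:
  assumes ver: "randomized_verifier n f X p"
    and le: "\<And>t Y. t \<in> set_pmf p \<Longrightarrow> queries t Y \<le> k"
  shows "RC n f X \<le> real k"
proof -
  have "expected_queries p Y \<le> of_nat k" for Y
  proof -
    have "expected_queries p Y \<le> (\<integral>\<^sup>+t. of_nat k \<partial>measure_pmf p)"
      unfolding expected_queries_def
      by (intro nn_integral_mono_AE) (auto simp: AE_measure_pmf_iff le)
    then show ?thesis by simp
  qed
  then have "(INF p \<in> {p. randomized_verifier n f X p}. SUP Y \<in> dom f. expected_queries p Y) \<le> of_nat k"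
    using ver by (intro INF_lower2[of p] SUP_least) auto
  \<comment> \<open>Finiteness of the upper bound \<open>of_nat k\<close> is what lets
    \<open>enn2real\<close> preserve the inequality.\<close>
  then show ?thesis unfolding RC_def
    by (metis enn2real_mono enn2real_of_nat of_nat_less_top)
qed

text \<open>The verifier draws \<open>k\<close> positions independently from \<open>p\<close> and
  rejects on a mismatch with \<open>X\<close>. It never rejects \<open>X\<close>, and it accepts
  \<open>Y\<close> only if all samples miss the difference set.\<close>

lemma RC_le_sample_size:
  assumes p: "set_pmf p \<subseteq> {..<n}"
    and bad: "\<And>Y. Y \<in> dom f \<Longrightarrow> f Y \<noteq> f X \<Longrightarrow> measure_pmf.prob p {i. Y ! i = X ! i} ^ k \<le> 1 / 2"
  shows "RC n f X \<le> real k"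
proof -
  let ?r = "map_pmf (check_tree X) (replicate_pmf k p)"
  have acc: "measure_pmf.prob ?r {t. accepts t Y} = measure_pmf.prob p {i. Y ! i = X ! i} ^ k" for Y
  proof -
    have "{js. accepts (check_tree X js) Y} = lists {i. Y ! i = X ! i}"
      by (auto simp: accepts_check_tree)
    then show ?thesis
      by (simp add: vimage_def prob_replicate_pmf_lists)
  qed
  show ?thesis
  proof (rule RC_le)
    show "randomized_verifier n f X ?r"
      unfolding randomized_verifier_def
    proof (intro conjI ballI impI)
      fix t assume "t \<in> set_pmf ?r"
      then show "wf_dtree n t" using p by (auto simp: set_replicate_pmf intro!: wf_check_tree)
    next
      show "measure_pmf.prob ?r {t. accepts t X} = 1" unfolding acc by simp
    next
      fix Y assume "Y \<in> dom f" "f Y \<noteq> f X"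
      then have "measure_pmf.prob ?r {t. accepts t Y} \<le> 1 / 2" using bad acc by simp
      moreover have "measure_pmf.prob ?r {t. \<not> accepts t Y} = 1 - measure_pmf.prob ?r {t. accepts t Y}"
        by (rule prob_Collect_not)
      ultimately show "measure_pmf.prob ?r {t. \<not> accepts t Y} \<ge> 1 / 2" by linarith
    qed
  next
    fix t Y assume "t \<in> set_pmf ?r"
    then show "queries t Y \<le> k"
      using queries_check_tree by (auto simp: set_replicate_pmf)
  qed
qed

text \<open>By \<open>1 - x \<le> exp (- x)\<close> the power is at most 1/e, and e is at least
  2.\<close>

lemma one_minus_inverse_power_le:
  assumes "k > 0" shows "(1 - 1 / real k) ^ k \<le> 1 / 2"
proof -
  have "(1 - 1 / real k) ^ k \<le> exp (- 1 / real k) ^ k"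
    using assms exp_ge_add_one_self[of "- 1 / real k"] by (intro power_mono) auto
  also have "\<dots> = exp (- 1)" using assms by (simp flip: exp_of_nat_mult)
  also have "\<dots> \<le> 1 / 2" using exp_ge_add_one_self[of 1] by (simp add: exp_minus field_simps)
  finally show ?thesis .
qed

lemma RC_le_quantum_queries:
  assumes ver: "quantum_verifier n f X Q" and n: "n \<ge> 1"
  shows "RC n f X \<le> 64 * (quantum_queries Q)\<^sup>2"
proof (cases "quantum_queries Q = 0")
  case True
  \<comment> \<open>Without queries the outcome is independent of the input, so accepting
    \<open>X\<close> with certainty leaves no input to be rejected, and the tree that always accepts
    is a verifier.\<close>
  then have "accept_prob n Q Y = accept_prob n Q X" for Y
    by (simp add: quantum_queries_def accept_prob_def final_state_def)
  then have const: "\<not> (Y \<in> dom f \<and> f Y \<noteq> f X)" for Y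
    using ver by (force simp: quantum_verifier_def)
  have "randomized_verifier n f X (return_pmf (Leaf True))"
    using const by (auto simp: randomized_verifier_def measure_return)
  from RC_le[OF this, of 0] show ?thesis using True by simp
next
  case False
  then obtain p where p: "set_pmf p \<subseteq> {..<n}"
    "\<And>Y. Y \<in> dom f \<Longrightarrow> f Y \<noteq> f X \<Longrightarrow>
       measure_pmf.prob p {i. Y ! i \<noteq> X ! i} \<ge> 1 / (64 * (quantum_queries Q)\<^sup>2)"
    using quantum_verifier_query_distribution[OF ver n] by blast
  \<comment> \<open>One sample hits the difference set with probability at least
    \<open>1 / ?k\<close>, so \<open>?k\<close> samples all miss it with probability at most
    1/2.\<close>
  let ?k = "64 * (quantum_queries Q)\<^sup>2"
  have "RC n f X \<le> real ?k"
  proof (rule RC_le_sample_size[OF p(1)])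
    fix Y assume Y: "Y \<in> dom f" "f Y \<noteq> f X"
    have "measure_pmf.prob p {i. Y ! i = X ! i} = 1 - measure_pmf.prob p {i. Y ! i \<noteq> X ! i}"
      using prob_Collect_not[of p "\<lambda>i. Y ! i \<noteq> X ! i"] by simp
    also have "\<dots> \<le> 1 - 1 / real ?k" using p(2)[OF Y] by simp
    finally have "measure_pmf.prob p {i. Y ! i = X ! i} ^ ?k \<le> (1 - 1 / real ?k) ^ ?k"
      by (intro power_mono) auto
    also have "\<dots> \<le> 1 / 2" using False by (intro one_minus_inverse_power_le) simp
    finally show "measure_pmf.prob p {i. Y ! i = X ! i} ^ ?k \<le> 1 / 2" .
  qed
  then show ?thesis by simp
qed

section \<open>From randomized to quantum verifiers\<close>

primrec path_queries :: "dtree \<Rightarrow> bool list \<Rightarrow> nat set" where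
  "path_queries (Leaf a) X = {}"
| "path_queries (Query i t0 t1) X = insert i (if X ! i then path_queries t1 X else path_queries t0 X)"

lemma path_queries_subset: "wf_dtree n t \<Longrightarrow> path_queries t X \<subseteq> {..<n}"
  by (induction t) auto

lemma finite_path_queries [simp]: "finite (path_queries t X)"
  by (induction t) auto

lemma card_path_queries: "card (path_queries t X) \<le> queries t X"
  by (induction t) (auto intro: order.trans[OF card_insert_le_m1] simp: card_insert_if)

text \<open>\<open>Y\<close> is led along the path of \<open>X\<close> to the same leaf.\<close>

lemma accepts_path_cong:
  "(\<And>i. i \<in> path_queries t X \<Longrightarrow> Y ! i = X ! i) \<Longrightarrow> accepts t Y = accepts t X"
  by (induction t) (auto split: if_splits)

text \<open>\<open>w i\<close> is the probability that position \<open>i\<close> is queried on input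
  \<open>X\<close>; the sum over \<open>i\<close> is the expected number of distinct queries. All
  trees in the support accept \<open>X\<close>, so a tree rejecting \<open>Y\<close> has a
  difference on the path of \<open>X\<close>, and the union bound turns the rejection probability
  into weight.\<close>

lemma randomized_verifier_weights:
  assumes ver: "randomized_verifier n f X p" and R: "expected_queries p X \<le> ennreal R"
  obtains w :: "nat \<Rightarrow> real" where "\<And>i. w i \<ge> 0" "(\<Sum>i<n. w i) \<le> max 0 R"
    "\<And>Y. Y \<in> dom f \<Longrightarrow> f Y \<noteq> f X \<Longrightarrow> (\<Sum>i | i < n \<and> Y ! i \<noteq> X ! i. w i) \<ge> 1 / 2"
proof -
  define w where "w i = measure_pmf.prob p {t. i \<in> path_queries t X}" for i
  have wf: "wf_dtree n t" if "t \<in> set_pmf p" for t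
    using ver that by (simp add: randomized_verifier_def)
  have "measure_pmf.prob p {t. accepts t X} = 1"
    using ver by (simp add: randomized_verifier_def)
  then have acc: "accepts t X" if "t \<in> set_pmf p" for t
    using that measure_pmf.prob_eq_1[of "{t. accepts t X}" p] by (simp add: AE_measure_pmf_iff)
  have "ennreal (\<Sum>i<n. w i) = (\<Sum>i<n. emeasure p {t. i \<in> path_queries t X})"
    by (simp add: w_def measure_pmf.emeasure_eq_measure sum_ennreal)
  also have "\<dots> = (\<Sum>i<n. \<integral>\<^sup>+t. indicator {t. i \<in> path_queries t X} t \<partial>measure_pmf p)"
    by simp
  also have "\<dots> = (\<integral>\<^sup>+t. (\<Sum>i<n. indicator {t. i \<in> path_queries t X} t) \<partial>measure_pmf p)"
    by (rule nn_integral_sum[symmetric]) simp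
  also have "\<dots> \<le> expected_queries p X"
    unfolding expected_queries_def
  proof (intro nn_integral_mono_AE, unfold AE_measure_pmf_iff, intro ballI)
    fix t assume t: "t \<in> set_pmf p"
    have "(\<Sum>i<n. indicator {t. i \<in> path_queries t X} t :: ennreal)
        = (\<Sum>i\<in>{..<n} \<inter> path_queries t X. 1)"
      unfolding sum.inter_restrict[OF finite_lessThan] by (intro sum.cong) (auto simp: indicator_def)
    also have "\<dots> = of_nat (card (path_queries t X))"
      using path_queries_subset[OF wf[OF t]] by (simp add: Int_absorb1)
    also have "\<dots> \<le> of_nat (queries t X)" by (intro of_nat_mono card_path_queries)
    finally show "(\<Sum>i<n. indicator {t. i \<in> path_queries t X} t :: ennreal) \<le> of_nat (queries t X)" .
  qed
  also note R
  \<comment> \<open>\<open>ennreal\<close> truncates negative reals to 0, hence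
    \<open>max 0 R\<close>.\<close>
  also have "ennreal R = ennreal (max 0 R)" by (simp add: max_def ennreal_neg)
  finally have sum: "(\<Sum>i<n. w i) \<le> max 0 R" by (simp only: ennreal_le_iff max.cobounded1)
  show ?thesis
  proof (rule that[OF _ sum])
    show "w i \<ge> 0" for i by (simp add: w_def)
    fix Y assume "Y \<in> dom f" "f Y \<noteq> f X"
    then have "1 / 2 \<le> measure_pmf.prob p {t. \<not> accepts t Y}"
      using ver by (simp add: randomized_verifier_def)
    also have "\<dots> \<le> measure_pmf.prob p (\<Union>i\<in>{i. i < n \<and> Y ! i \<noteq> X ! i}. {t. i \<in> path_queries t X})"
    proof (intro measure_pmf.finite_measure_mono_AE, unfold AE_measure_pmf_iff, intro ballI impI)
      fix t assume t: "t \<in> set_pmf p" and "t \<in> {t. \<not> accepts t Y}"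
      then have "accepts t Y \<noteq> accepts t X" using acc by auto
      then obtain i where "i \<in> path_queries t X" "Y ! i \<noteq> X ! i"
        using accepts_path_cong[of t X Y] by blast
      then show "t \<in> (\<Union>i\<in>{i. i < n \<and> Y ! i \<noteq> X ! i}. {t. i \<in> path_queries t X})"
        using path_queries_subset[OF wf[OF t]] by auto
    qed simp
    also have "\<dots> \<le> (\<Sum>i | i < n \<and> Y ! i \<noteq> X ! i. w i)"
      unfolding w_def by (intro measure_pmf.finite_measure_subadditive_finite) auto
    finally show "(\<Sum>i | i < n \<and> Y ! i \<noteq> X ! i. w i) \<ge> 1 / 2" .
  qed
qed

section \<open>The Grover iteration on real amplitudes\<close>

text \<open>In operator form \<open>(2 |s><s| - I) diag \<sigma>\<close>: a phase oracle with signs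
  \<open>\<sigma>\<close>, then the reflection about \<open>s\<close>.\<close>

definition grover :: "nat \<Rightarrow> (nat \<Rightarrow> real) \<Rightarrow> (nat \<Rightarrow> real) \<Rightarrow> (nat \<Rightarrow> real) \<Rightarrow> nat \<Rightarrow> real" where
  "grover n s \<sigma> g = (\<lambda>i. 2 * s i * (\<Sum>j<n. s j * (\<sigma> j * g j)) - \<sigma> i * g i)"

lemma inner_grover:
  "(\<Sum>i<n. u i * grover n s \<sigma> g i)
     = 2 * (\<Sum>i<n. u i * s i) * (\<Sum>j<n. s j * (\<sigma> j * g j)) - (\<Sum>i<n. u i * (\<sigma> i * g i))"
  by (simp add: grover_def algebra_simps sum_subtractf sum_distrib_left sum_distrib_right)

context
  fixes n :: nat and s \<sigma> :: "nat \<Rightarrow> real"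
  assumes s: "(\<Sum>i<n. (s i)\<^sup>2) = 1" and \<sigma>: "\<And>i. \<sigma> i = 1 \<or> \<sigma> i = -1"
begin

text \<open>Sign flips and the reflection about the unit vector \<open>s\<close> are
  isometries.\<close>

lemma sum_grover_power2: "(\<Sum>i<n. (grover n s \<sigma> g i)\<^sup>2) = (\<Sum>i<n. (g i)\<^sup>2)"
proof -
  define K where "K = (\<Sum>j<n. s j * (\<sigma> j * g j))"
  have "(grover n s \<sigma> g i)\<^sup>2 = 4 * K\<^sup>2 * (s i)\<^sup>2 - 4 * K * (s i * (\<sigma> i * g i)) + (g i)\<^sup>2" for i
  proof -
    have g_eq: "grover n s \<sigma> g i = 2 * s i * K - \<sigma> i * g i" by (simp add: grover_def K_def)
    show ?thesis unfolding g_eq using \<sigma>[of i] by (auto simp: power2_eq_square algebra_simps)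
  qed
  then have "(\<Sum>i<n. (grover n s \<sigma> g i)\<^sup>2)
      = 4 * K\<^sup>2 * (\<Sum>i<n. (s i)\<^sup>2) - 4 * K * (\<Sum>i<n. s i * (\<sigma> i * g i)) + (\<Sum>i<n. (g i)\<^sup>2)"
    by (simp add: sum.distrib sum_subtractf flip: sum_distrib_left)
  then show ?thesis using s by (simp add: K_def[symmetric] power2_eq_square)
qed

lemma sum_grover_iterate_power2: "(\<Sum>i<n. ((grover n s \<sigma> ^^ k) s i)\<^sup>2) = 1"
  by (induction k) (simp_all add: s sum_grover_power2)

text \<open>
  With \<open>W\<close> the Grover iteration and \<open>u\<close> the solution of \<open>(I - W\<^sup>T) u = s\<close>, the sum telescopes to
  \<open>\<langle>u, W s - W\<^sup>m\<^sup>+\<^sup>1 s\<rangle>\<close>.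
\<close>

lemma sum_grover_iterates_le:
  assumes "p = (\<Sum>i | i < n \<and> \<sigma> i = -1. (s i)\<^sup>2)" and p: "p > 0"
  shows "\<bar>\<Sum>z<m. \<Sum>i<n. s i * (grover n s \<sigma> ^^ Suc z) s i\<bar> \<le> 1 / sqrt p"
proof -
  let ?b = "\<lambda>i. of_bool (\<sigma> i = -1) :: real"
  \<comment> \<open>The equation for \<open>u\<close> forces \<open>u = s\<close> on the unmarked
    positions and \<open>\<langle>u, s\<rangle> = 1 / 2\<close>. On the marked ones \<open>u\<close>
    is taken parallel to \<open>s\<close>, which makes its norm as small as possible.\<close>
  define u where "u i = s i - s i * ?b i / (2 * p)" for i
  have p_eq: "(\<Sum>i<n. (s i)\<^sup>2 * ?b i) = p"
    unfolding assms(1) by (subst sum.mono_neutral_cong_right[where S="{i. i < n \<and> \<sigma> i = -1}"]) auto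
  have "(\<Sum>i<n. u i * s i) = (\<Sum>i<n. (s i)\<^sup>2 - (s i)\<^sup>2 * ?b i / (2 * p))"
    by (intro sum.cong) (auto simp: u_def power2_eq_square algebra_simps)
  also have "\<dots> = 1 - p / (2 * p)"
    by (simp add: sum_subtractf s p_eq flip: sum_divide_distrib)
  finally have us: "(\<Sum>i<n. u i * s i) = 1 / 2" using p by simp
  have "(u i)\<^sup>2 = (s i)\<^sup>2 + (s i)\<^sup>2 * ?b i * (1 / (4 * p\<^sup>2) - 1 / p)" for i
    by (cases "\<sigma> i = -1") (use p in \<open>auto simp: u_def power2_eq_square field_simps\<close>)
  then have "(\<Sum>i<n. (u i)\<^sup>2) = 1 + p * (1 / (4 * p\<^sup>2) - 1 / p)"
    by (simp add: sum.distrib s p_eq flip: sum_distrib_right)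
  then have uu: "(\<Sum>i<n. (u i)\<^sup>2) = 1 / (4 * p)"
    using p by (simp add: power2_eq_square field_simps)
  \<comment> \<open>Cauchy-Schwarz: the iterates are unit vectors and \<open>u\<close> has norm
    \<open>1 / (2 * sqrt p)\<close>.\<close>
  have ug: "\<bar>\<Sum>i<n. u i * (grover n s \<sigma> ^^ k) s i\<bar> \<le> 1 / (2 * sqrt p)" for k
  proof -
    have "(\<Sum>i<n. u i * (grover n s \<sigma> ^^ k) s i)\<^sup>2 \<le> 1 / (4 * p)"
      using Cauchy_Schwarz_ineq_sum[of u "(grover n s \<sigma> ^^ k) s" "{..<n}"]
      by (simp add: uu sum_grover_iterate_power2)
    also have "\<dots> = (1 / (2 * sqrt p))\<^sup>2" using p by (simp add: power_divide power_mult_distrib)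
    finally show ?thesis using p by (intro power2_le_imp_le[of "\<bar>_\<bar>"]) auto
  qed
  have step: "(\<Sum>i<n. s i * g i) = (\<Sum>i<n. u i * g i) - (\<Sum>i<n. u i * grover n s \<sigma> g i)" for g
  proof -
    have e: "s i * g i = u i * g i - (s i * (\<sigma> i * g i) - u i * (\<sigma> i * g i))" for i
      using \<sigma>[of i] by (auto simp: u_def algebra_simps)
    show ?thesis
      unfolding inner_grover us by (subst e) (simp add: sum_subtractf)
  qed
  have "(\<Sum>z<m. \<Sum>i<n. s i * (grover n s \<sigma> ^^ Suc z) s i)
      = (\<Sum>i<n. u i * (grover n s \<sigma> ^^ 1) s i) - (\<Sum>i<n. u i * (grover n s \<sigma> ^^ Suc m) s i)"
  proof (induction m)
    case (Suc m)
    then show ?case using step[of "(grover n s \<sigma> ^^ Suc m) s"] by simp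
  qed simp
  also have "\<bar>\<dots>\<bar> \<le> 1 / (2 * sqrt p) + 1 / (2 * sqrt p)"
    using ug[of 1] ug[of "Suc m"] by linarith
  finally show ?thesis by simp
qed

end

lemma inner_grover_diffusion:
  assumes "(\<Sum>i<n. (s i)\<^sup>2) = 1"
  shows "(\<Sum>i<n. s i * grover n s (\<lambda>_. 1) g i) = (\<Sum>i<n. s i * g i)"
  using inner_grover[of s n s "\<lambda>_. 1" g] assms by (simp add: power2_eq_square)

lemma grover_diffusion_self:
  assumes "(\<Sum>i<n. (s i)\<^sup>2) = 1"
  shows "grover n s (\<lambda>_. 1) s = s"
  using assms by (simp add: grover_def power2_eq_square)

section \<open>Unitary matrices acting on real vectors\<close>

text \<open>All states of the constructed algorithm have real amplitudes; this embedding keeps their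
  analysis in the reals.\<close>

definition rvec :: "nat \<Rightarrow> (nat \<Rightarrow> real) \<Rightarrow> complex Matrix.vec" where
  "rvec N g = Matrix.vec N (\<lambda>k. complex_of_real (g k))"

lemma rvec_carrier [simp]: "rvec N g \<in> carrier_vec N"
  by (simp add: rvec_def)

lemma vec_index_rvec: "k < N \<Longrightarrow> vec_index (rvec N g) k = complex_of_real (g k)"
  by (simp add: rvec_def)

lemma rvec_cong: "(\<And>k. k < N \<Longrightarrow> g k = h k) \<Longrightarrow> rvec N g = rvec N h"
  by (auto simp: rvec_def)

lemma query_mat_mult_rvec:
  "query_mat n w Y *\<^sub>v rvec (n * 2 * w) g = rvec (n * 2 * w) (\<lambda>k. g (query_perm w Y k))"
  by (auto simp: query_mat_mult_vec rvec_def query_perm_less)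

definition sign_mat :: "nat \<Rightarrow> (nat \<Rightarrow> real) \<Rightarrow> complex Matrix.mat" where
  "sign_mat N f = Matrix.mat N N (\<lambda>(r, c). if r = c then complex_of_real (f r) else 0)"

lemma unitary_sign_mat:
  assumes "\<And>k. f k = 1 \<or> f k = -1"
  shows "unitary_mat N (sign_mat N f)"
proof (rule unitary_matI)
  fix r c assume rc: "r < N" "c < N"
  have "complex_of_real (f k) * of_real (f k) = 1" for k using assms[of k] by auto
  then have "(\<Sum>k<N. cnj (sign_mat N f $$ (k, r)) * sign_mat N f $$ (k, c))
      = (\<Sum>k<N. if k = r then of_bool (r = c) else 0)"
    using rc by (intro sum.cong) (auto simp: sign_mat_def)
  then show "(\<Sum>k<N. cnj (sign_mat N f $$ (k, r)) * sign_mat N f $$ (k, c)) = of_bool (r = c)"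
    using rc by simp
qed (simp add: sign_mat_def)

lemma sign_mat_mult_rvec: "sign_mat N f *\<^sub>v rvec N g = rvec N (\<lambda>k. f k * g k)"
proof (rule eq_vecI)
  fix k assume "k < dim_vec (rvec N (\<lambda>k. f k * g k))"
  then have k: "k < N" by (simp add: rvec_def)
  have "vec_index (sign_mat N f *\<^sub>v rvec N g) k
      = (\<Sum>c<N. if c = k then of_real (f k) * of_real (g k) else 0)"
    using k by (auto simp: sign_mat_def rvec_def scalar_prod_def atLeast0LessThan simp del: sum.delta sum.delta' intro!: sum.cong)
  then show "vec_index (sign_mat N f *\<^sub>v rvec N g) k = vec_index (rvec N (\<lambda>k. f k * g k)) k"
    using k by (simp add: rvec_def)
qed (simp add: sign_mat_def rvec_def)

text \<open>For an orthogonal projection \<open>P\<close> this is the reflection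
  \<open>2 P - I\<close>. A rank-one \<open>P\<close> gives the state preparation,
  \<open>diffusion\<close> the Grover diffusion in all branches at once.\<close>

definition reflection_mat :: "nat \<Rightarrow> (nat \<Rightarrow> nat \<Rightarrow> real) \<Rightarrow> complex Matrix.mat" where
  "reflection_mat N P =
     Matrix.mat N N (\<lambda>(r, c). complex_of_real (2 * P r c - of_bool (r = c)))"

lemma unitary_reflection_mat:
  assumes sym: "\<And>r c. r < N \<Longrightarrow> c < N \<Longrightarrow> P r c = P c r"
    and idem: "\<And>r c. r < N \<Longrightarrow> c < N \<Longrightarrow> (\<Sum>k<N. P r k * P k c) = P r c"
  shows "unitary_mat N (reflection_mat N P)"
proof (rule unitary_matI)
  fix r c assume rc: "r < N" "c < N"
  have "(\<Sum>k<N. cnj (reflection_mat N P $$ (k, r)) * reflection_mat N P $$ (k, c))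
      = (\<Sum>k<N. complex_of_real ((2 * P r k - of_bool (k = r)) * (2 * P k c - of_bool (k = c))))"
    using rc by (intro sum.cong) (auto simp: reflection_mat_def sym)
  also have "\<dots> = complex_of_real (\<Sum>k<N. 4 * (P r k * P k c) - (if k = r then 2 * P r c else 0)
      - (if k = c then 2 * P r c else 0) + (if k = r then of_bool (r = c) else 0))"
    unfolding of_real_sum[symmetric]
    by (intro arg_cong[of _ _ complex_of_real] sum.cong) (auto simp: algebra_simps)
  also have "\<dots> = of_bool (r = c)"
    using rc by (simp add: sum.distrib sum_subtractf idem flip: sum_distrib_left)
  finally show "(\<Sum>k<N. cnj (reflection_mat N P $$ (k, r)) * reflection_mat N P $$ (k, c)) = of_bool (r = c)" .
qed (simp add: reflection_mat_def)

lemma reflection_mat_mult_rvec: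
  "reflection_mat N P *\<^sub>v rvec N g = rvec N (\<lambda>r. 2 * (\<Sum>c<N. P r c * g c) - g r)"
proof (rule eq_vecI)
  fix k assume "k < dim_vec (rvec N (\<lambda>r. 2 * (\<Sum>c<N. P r c * g c) - g r))"
  then have k: "k < N" by (simp add: rvec_def)
  have "vec_index (reflection_mat N P *\<^sub>v rvec N g) k
      = (\<Sum>c<N. complex_of_real (2 * P k c - of_bool (k = c)) * complex_of_real (g c))"
    using k by (simp add: reflection_mat_def rvec_def scalar_prod_def atLeast0LessThan)
  also have "\<dots> = complex_of_real (\<Sum>c<N. 2 * (P k c * g c) - (if c = k then g k else 0))"
    unfolding of_real_sum of_real_mult[symmetric]
    by (intro sum.cong arg_cong[of _ _ complex_of_real]) (auto simp: algebra_simps)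
  also have "(\<Sum>c<N. 2 * (P k c * g c) - (if c = k then g k else 0)) = 2 * (\<Sum>c<N. P k c * g c) - g k"
    using k by (simp add: sum_subtractf flip: sum_distrib_left)
  finally show "vec_index (reflection_mat N P *\<^sub>v rvec N g) k
      = vec_index (rvec N (\<lambda>r. 2 * (\<Sum>c<N. P r c * g c) - g r)) k"
    using k by (simp add: rvec_def)
qed (simp add: reflection_mat_def rvec_def)

text \<open>\<open>H\<close> is the reflection about the line bisecting \<open>\<phi>\<close> and the first basis vector.\<close>

lemma unitary_swapping_first_basis_vec:
  fixes \<phi> :: "nat \<Rightarrow> real"
  assumes \<phi>: "(\<Sum>k<N. (\<phi> k)\<^sup>2) = 1" "\<phi> 0 \<ge> 0" and N: "N > 0"
  obtains H where "unitary_mat N H" "H *\<^sub>v unit_vec N 0 = rvec N \<phi>"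
    "\<And>g. vec_index (H *\<^sub>v rvec N g) 0 = complex_of_real (\<Sum>k<N. \<phi> k * g k)"
proof -
  \<comment> \<open>\<open>v\<close> spans the bisecting line. Its squared norm is
    \<open>2 * a\<close>, the denominator of \<open>P\<close>, and \<open>\<phi> 0 \<ge> 0\<close>
    keeps \<open>a\<close> positive.\<close>
  define v where "v k = \<phi> k + of_bool (k = 0)" for k
  define a where "a = 1 + \<phi> 0"
  define P where "P r c = v r * v c / (2 * a)" for r c
  define H where "H = reflection_mat N P"
  have a: "a > 0" using \<phi> by (simp add: a_def)
  have v_sum: "(\<Sum>k<N. v k * g k) = (\<Sum>k<N. \<phi> k * g k) + g 0" for g
  proof -
    have "(\<Sum>k<N. v k * g k) = (\<Sum>k<N. \<phi> k * g k + (if k = 0 then g 0 else 0))"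
      by (intro sum.cong) (auto simp: v_def algebra_simps)
    then show ?thesis using N by (simp add: sum.distrib)
  qed
  have P_sum: "(\<Sum>k<N. P r k * g k) = v r / (2 * a) * (\<Sum>k<N. v k * g k)" for r g
    by (simp add: P_def sum_distrib_left mult_ac)
  have "(\<Sum>k<N. \<phi> k * v k) = a"
    using v_sum[of \<phi>] \<phi> by (simp add: a_def power2_eq_square mult.commute)
  then have vv: "(\<Sum>k<N. v k * v k) = 2 * a"
    using v_sum[of v] by (simp add: v_def a_def)
  have "unitary_mat N H" unfolding H_def
  proof (rule unitary_reflection_mat)
    show "(\<Sum>k<N. P r k * P k c) = P r c" for r c
    proof -
      have "(\<Sum>k<N. v k * P k c) = (\<Sum>k<N. v k * v k) * v c / (2 * a)"
        by (simp add: P_def sum_distrib_left sum_distrib_right sum_divide_distrib mult_ac)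
      then show ?thesis using a by (simp add: P_sum vv) (simp add: P_def)
    qed
  qed (simp add: P_def)
  moreover have "H *\<^sub>v unit_vec N 0 = rvec N \<phi>"
  proof -
    have e: "unit_vec N 0 = rvec N (\<lambda>k. of_bool (k = 0))" by (auto simp: unit_vec_def rvec_def)
    have ve: "(\<Sum>k<N. v k * of_bool (k = 0)) = a"
      unfolding v_sum[of "\<lambda>k. of_bool (k = 0)"] using N by (simp add: a_def Int_absorb1)
    show ?thesis
      unfolding e H_def reflection_mat_mult_rvec P_sum ve
      using a by (intro rvec_cong) (simp add: v_def field_simps)
  qed
  \<comment> \<open>\<open>H\<close> is symmetric, so its first row is its first column
    \<open>\<phi>\<close>: outcome 0 after \<open>H\<close> tests for the state
    \<open>\<phi>\<close>.\<close>
  moreover have "vec_index (H *\<^sub>v rvec N g) 0 = complex_of_real (\<Sum>k<N. \<phi> k * g k)" for g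
  proof -
    have "2 * (v 0 / (2 * a) * (\<Sum>k<N. v k * g k)) - g 0 = (\<Sum>k<N. \<phi> k * g k)"
    proof -
      have "v 0 = a" by (simp add: v_def a_def)
      then show ?thesis using a by (simp add: v_sum add_divide_distrib)
    qed
    then show ?thesis
      by (simp only: H_def reflection_mat_mult_rvec P_sum vec_index_rvec[OF N])
  qed
  ultimately show ?thesis using that by blast
qed

section \<open>Grover search with a superposed number of iterations\<close>

text \<open>
  Branch \<open>z\<close> of the workspace performs \<open>z + 1\<close> Grover iterations with the answer bit in state
  \<open>|-\<rangle>\<close>, then idles with the answer bit in state \<open>|+\<rangle>\<close>, where a query has no effect.
\<close>

primrec branch :: "nat \<Rightarrow> (nat \<Rightarrow> real) \<Rightarrow> (nat \<Rightarrow> real) \<Rightarrow> nat \<Rightarrow> nat \<Rightarrow> nat \<Rightarrow> real" where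
  "branch n s \<sigma> z 0 = s"
| "branch n s \<sigma> z (Suc t) = grover n s (if t \<le> z then \<sigma> else (\<lambda>_. 1)) (branch n s \<sigma> z t)"

lemma branch_active: "t \<le> Suc z \<Longrightarrow> branch n s \<sigma> z t = (grover n s \<sigma> ^^ t) s"
  by (induction t) auto

text \<open>Idle steps are the bare reflection about \<open>s\<close>, which preserves the overlap
  with \<open>s\<close>; so this overlap freezes after \<open>z + 1\<close> steps.\<close>

lemma inner_branch:
  assumes "(\<Sum>i<n. (s i)\<^sup>2) = 1"
  shows "(\<Sum>i<n. s i * branch n s \<sigma> z t i) = (\<Sum>i<n. s i * (grover n s \<sigma> ^^ min t (Suc z)) s i)"
proof (induction t)
  case (Suc t)
  show ?case
  proof (cases "t \<le> z")
    case True
    then have "min (Suc t) (Suc z) = Suc t" by simp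
    then show ?thesis using branch_active[of "Suc t" z n s \<sigma>] True by (simp only: Suc_le_mono)
  next
    case False
    then have "min (Suc t) (Suc z) = min t (Suc z)" by simp
    then show ?thesis using False Suc.IH inner_grover_diffusion[OF assms] by (simp del: funpow.simps)
  qed
qed simp

text \<open>The state after \<open>t\<close> rounds: \<open>k mod m\<close> is the branch,
  \<open>k div m mod 2\<close> the answer bit, \<open>k div (2 * m)\<close> the query index.
  Branches from \<open>t\<close> on still hold the answer bit in the minus state. The root
  normalizes the superposition of \<open>m\<close> branches and two bit values.\<close>

definition grover_state :: "nat \<Rightarrow> nat \<Rightarrow> (nat \<Rightarrow> real) \<Rightarrow> (nat \<Rightarrow> real) \<Rightarrow> nat \<Rightarrow> nat \<Rightarrow> real" where
  "grover_state n m s \<sigma> t k =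
     (if t \<le> k mod m \<and> k div m mod 2 = 1 then -1 else 1) *
     branch n s \<sigma> (k mod m) t (k div (2 * m)) / sqrt (2 * m)"

text \<open>
  The first factor turns the phase \<open>(-1)\<^sup>y\<close> of a query into one that marks the differences from \<open>X\<close>;
  the second maps \<open>|-\<rangle>\<close> to \<open>|+\<rangle>\<close> in the branch that has just made its last query.
\<close>

definition correction :: "nat \<Rightarrow> bool list \<Rightarrow> nat \<Rightarrow> nat \<Rightarrow> real" where
  "correction m X t k =
     (if t \<le> k mod m \<and> X ! (k div (2 * m)) then -1 else 1) *
     (if t = k mod m \<and> k div m mod 2 = 1 then -1 else 1)"

definition diffusion :: "nat \<Rightarrow> (nat \<Rightarrow> real) \<Rightarrow> nat \<Rightarrow> nat \<Rightarrow> real" where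
  "diffusion m s r c =
     (if c div m mod 2 = r div m mod 2 then if c mod m = r mod m
      then s (r div (2 * m)) * s (c div (2 * m)) else 0 else 0)"

definition grover_unitary :: "nat \<Rightarrow> nat \<Rightarrow> (nat \<Rightarrow> real) \<Rightarrow> bool list \<Rightarrow> nat \<Rightarrow> complex Matrix.mat" where
  "grover_unitary n m s X t =
     reflection_mat (n * 2 * m) (diffusion m s) * sign_mat (n * 2 * m) (correction m X t)"

lemma sum_diffusion:
  assumes "b < 2" "z < m"
  shows "(\<Sum>c<n * 2 * m. diffusion m s (basis_index m i b z) c * g c)
    = s i * (\<Sum>j<n. s j * g (basis_index m j b z))"
proof -
  have "(\<Sum>c<n * 2 * m. diffusion m s (basis_index m i b z) c * g c)
      = (\<Sum>j<n. \<Sum>b'<2. if b' = b then \<Sum>z'<m. if z' = z then s i * s j * g (basis_index m j b z) else 0 else 0)"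
    unfolding sum_basis_index using assms
    by (intro sum.cong refl) (auto simp: diffusion_def simp del: sum.delta sum.delta' intro!: sum.cong sum.neutral)
  also have "\<dots> = s i * (\<Sum>j<n. s j * g (basis_index m j b z))"
    using assms by (simp add: sum_distrib_left mult.assoc)
  finally show ?thesis .
qed

lemma unitary_grover_unitary:
  assumes s: "(\<Sum>i<n. (s i)\<^sup>2) = 1"
  shows "unitary_mat (n * 2 * m) (grover_unitary n m s X t)"
  unfolding grover_unitary_def
proof (intro unitary_mat_mult unitary_reflection_mat unitary_sign_mat)
  fix r c
  show "diffusion m s r c = diffusion m s c r" by (auto simp: diffusion_def)
  assume "r < n * 2 * m"
  then obtain i b z where r: "r = basis_index m i b z" "b < 2" "z < m" by (rule basis_index_cases)
  \<comment> \<open>Rows with the same answer bit and branch are proportional, with the entries of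
    \<open>s\<close> as factors. Dividing by \<open>s i\<close> expresses them by row
    \<open>r\<close>; if \<open>s i = 0\<close>, row \<open>r\<close> vanishes.\<close>
  have "(\<Sum>j<n. s j * diffusion m s (basis_index m j b z) c) = (\<Sum>j<n. (s j)\<^sup>2) * (diffusion m s r c / s i)"
    if "s i \<noteq> 0"
    unfolding sum_distrib_right
    using r that by (intro sum.cong) (auto simp: diffusion_def power2_eq_square)
  then show "(\<Sum>k<n * 2 * m. diffusion m s r k * diffusion m s k c) = diffusion m s r c"
    using s r by (cases "s i = 0") (simp_all add: sum_diffusion, simp add: diffusion_def)
next
  fix k show "correction m X t k = 1 \<or> correction m X t k = -1" by (simp add: correction_def)
qed

text \<open>On the minus state a query acts as a phase, which the correction turns into
  \<open>\<sigma>\<close>; on the plus state it acts trivially. The diffusion then completes a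
  Grover step for each answer bit and branch separately.\<close>

lemma grover_unitary_step:
  fixes X Y :: "bool list"
  defines "\<sigma> \<equiv> \<lambda>i. if Y ! i = X ! i then 1 else -1 :: real"
  shows "grover_unitary n m s X t *\<^sub>v (query_mat n m Y *\<^sub>v rvec (n * 2 * m) (grover_state n m s \<sigma> t))
    = rvec (n * 2 * m) (grover_state n m s \<sigma> (Suc t))"
proof -
  let ?N = "n * 2 * m"
  let ?h = "\<lambda>k. correction m X t k * grover_state n m s \<sigma> t (query_perm m Y k)"
  \<comment> \<open>The amplitude of the answer bit once the correction has acted: branch
    \<open>t\<close> is already in the plus state, hence \<open>Suc t \<le> z\<close>.\<close>
  let ?\<tau> = "\<lambda>b z. (if Suc t \<le> z \<and> b = (1::nat) then -1 else 1) / sqrt (2 * m) :: real"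
  have h: "?h (basis_index m i b z)
      = ?\<tau> b z * ((if t \<le> z then \<sigma> else (\<lambda>_. 1)) i * branch n s \<sigma> z t i)"
    if "b < 2" "z < m" for i b z
  proof -
    from \<open>b < 2\<close> consider "b = 0" | "b = 1" by linarith
    then show ?thesis
      using \<open>z < m\<close> by cases (auto simp: grover_state_def correction_def query_perm_basis_index \<sigma>_def)
  qed
  have "grover_unitary n m s X t *\<^sub>v (query_mat n m Y *\<^sub>v rvec ?N (grover_state n m s \<sigma> t))
      = reflection_mat ?N (diffusion m s) *\<^sub>v
          (sign_mat ?N (correction m X t) *\<^sub>v (query_mat n m Y *\<^sub>v rvec ?N (grover_state n m s \<sigma> t)))"
    unfolding grover_unitary_def query_mat_mult_rvec
    by (rule assoc_mult_mat_vec) (auto simp: reflection_mat_def sign_mat_def)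
  also have "\<dots> = rvec ?N (\<lambda>r. 2 * (\<Sum>c<?N. diffusion m s r c * ?h c) - ?h r)"
    by (simp only: query_mat_mult_rvec sign_mat_mult_rvec reflection_mat_mult_rvec)
  also have "\<dots> = rvec ?N (grover_state n m s \<sigma> (Suc t))"
  proof (rule rvec_cong)
    fix k assume "k < ?N"
    then obtain i b z where k: "i < n" "b < 2" "z < m" "k = basis_index m i b z" by (rule basis_index_cases)
    have "(\<Sum>j<n. s j * ?h (basis_index m j b z))
        = ?\<tau> b z * (\<Sum>j<n. s j * ((if t \<le> z then \<sigma> else (\<lambda>_. 1)) j * branch n s \<sigma> z t j))"
      unfolding h[OF k(2,3)] sum_distrib_left by (intro sum.cong) auto
    then have "2 * (\<Sum>c<?N. diffusion m s k c * ?h c) - ?h k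
        = ?\<tau> b z * branch n s \<sigma> z (Suc t) i"
      unfolding k(4) sum_diffusion[OF k(2,3)] h[OF k(2,3)]
      by (simp only: branch.simps grover_def) (simp add: algebra_simps)
    also have "\<dots> = grover_state n m s \<sigma> (Suc t) k"
      using k by (simp add: grover_state_def del: branch.simps)
    finally show "2 * (\<Sum>c<?N. diffusion m s k c * ?h c) - ?h k = grover_state n m s \<sigma> (Suc t) k" .
  qed
  finally show ?thesis .
qed

text \<open>
  The accepting amplitude is the average over \<open>z\<close> of \<open>\<langle>s, W\<^sup>z\<^sup>+\<^sup>1 s\<rangle>\<close> for the Grover iteration \<open>W\<close>,
  hence is 1 for \<open>Y = X\<close> and small as soon as \<open>Y\<close> differs from \<open>X\<close> on enough of the weight of \<open>s\<close>.
\<close>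

lemma grover_quantum_alg:
  assumes s: "(\<Sum>i<n. (s i)\<^sup>2) = 1" "s 0 \<ge> 0" and n: "n \<ge> 1" and m: "m \<ge> 1"
  obtains Q where "wf_quantum_alg n Q" "quantum_queries Q = m"
    "\<And>Y. accept_prob n Q Y =
      ((\<Sum>z<m. \<Sum>i<n. s i * (grover n s (\<lambda>i. if Y ! i = X ! i then 1 else -1) ^^ Suc z) s i) / m)\<^sup>2"
proof -
  let ?N = "n * 2 * m"
  let ?\<sigma> = "\<lambda>Y i. if Y ! i = X ! i then 1 else -1 :: real"
  let ?U = "grover_unitary n m s X"
  define \<phi> where "\<phi> = grover_state n m s (\<lambda>_. 1) 0"
  \<comment> \<open>After \<open>m\<close> rounds all branches are idle, so the final test compares
    with the start state with plus in place of minus.\<close>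
  define \<phi>' where "\<phi>' k = s (k div (2 * m)) / sqrt (2 * m)" for k
  have N: "?N > 0" using n m by simp
  have \<phi>_start: "\<phi> = grover_state n m s (?\<sigma> Y) 0" for Y
    by (simp add: \<phi>_def grover_state_def fun_eq_iff)
  have sq: "(\<phi> k)\<^sup>2 = (s (k div (2 * m)))\<^sup>2 / (2 * m)" "(\<phi>' k)\<^sup>2 = (s (k div (2 * m)))\<^sup>2 / (2 * m)" for k
    by (simp_all add: \<phi>_def \<phi>'_def grover_state_def power_divide power_mult_distrib)
  have "(\<Sum>k<?N. (s (k div (2 * m)))\<^sup>2 / (2 * m)) = (\<Sum>i<n. \<Sum>b<(2::nat). \<Sum>z<m. (s i)\<^sup>2 / (2 * m))"
    unfolding sum_basis_index by (intro sum.cong) auto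
  also have "\<dots> = (\<Sum>i<n. (s i)\<^sup>2)" using m by simp
  finally have norm: "(\<Sum>k<?N. (\<phi> k)\<^sup>2) = 1" "(\<Sum>k<?N. (\<phi>' k)\<^sup>2) = 1"
    using s by (simp_all add: sq)
  have nonneg: "\<phi> 0 \<ge> 0" "\<phi>' 0 \<ge> 0" using s by (simp_all add: \<phi>_def \<phi>'_def grover_state_def)
  obtain H where H: "unitary_mat ?N H" "H *\<^sub>v unit_vec ?N 0 = rvec ?N \<phi>"
    using unitary_swapping_first_basis_vec[OF norm(1) nonneg(1) N] by blast
  obtain H' where H': "unitary_mat ?N H'"
    "\<And>g. vec_index (H' *\<^sub>v rvec ?N g) 0 = complex_of_real (\<Sum>k<?N. \<phi>' k * g k)"
    using unitary_swapping_first_basis_vec[OF norm(2) nonneg(2) N] by blast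
  \<comment> \<open>The basis change of the final test is merged into the last unitary, which leaves
    exactly \<open>m\<close> queries.\<close>
  define Us where "Us = map ?U [0..<m - 1] @ [H' * ?U (m - 1)]"
  define Q where "Q = \<lparr>workspace = m, first_unitary = H, later_unitaries = Us, accepting = {0}\<rparr>"
  have U: "unitary_mat ?N (?U t)" for t by (rule unitary_grover_unitary[OF s(1)])
  have "wf_quantum_alg n Q"
    using m N H(1) U unitary_mat_mult[OF H'(1) U] by (auto simp: wf_quantum_alg_def Q_def Us_def)
  moreover have "quantum_queries Q = m"
    using m by (simp add: quantum_queries_def Q_def Us_def)
  moreover have "accept_prob n Q Y =
      ((\<Sum>z<m. \<Sum>i<n. s i * (grover n s (?\<sigma> Y) ^^ Suc z) s i) / m)\<^sup>2" for Y
  proof -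
    let ?\<psi> = "grover_state n m s (?\<sigma> Y)"
    have run: "run n m Y (rvec ?N \<phi>) (map ?U [0..<t]) = rvec ?N (?\<psi> t)" for t
      by (induction t) (simp_all add: \<phi>_start[of Y] grover_unitary_step)
    have "final_state n Q Y = (H' * ?U (m - 1)) *\<^sub>v (query_mat n m Y *\<^sub>v rvec ?N (?\<psi> (m - 1)))"
      by (simp add: final_state_run Q_def Us_def H(2) run)
    also have "\<dots> = H' *\<^sub>v (?U (m - 1) *\<^sub>v (query_mat n m Y *\<^sub>v rvec ?N (?\<psi> (m - 1))))"
      unfolding query_mat_mult_rvec
      by (rule assoc_mult_mat_vec[OF unitary_mat_carrier[OF H'(1)] unitary_mat_carrier[OF U]]) simp
    also have "\<dots> = H' *\<^sub>v rvec ?N (?\<psi> m)"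
      using m by (simp add: grover_unitary_step)
    finally have "accept_prob n Q Y = (\<Sum>k<?N. \<phi>' k * ?\<psi> m k)\<^sup>2"
      by (simp add: accept_prob_def Q_def H'(2) del: of_real_sum of_real_mult)
    also have "(\<Sum>k<?N. \<phi>' k * ?\<psi> m k) = (\<Sum>i<n. \<Sum>b<(2::nat). \<Sum>z<m. s i * branch n s (?\<sigma> Y) z m i / (2 * m))"
      unfolding sum_basis_index by (intro sum.cong) (auto simp: \<phi>'_def grover_state_def)
    also have "\<dots> = (\<Sum>z<m. \<Sum>i<n. s i * branch n s (?\<sigma> Y) z m i) / m"
      by (subst sum.swap) (simp add: sum_divide_distrib sum_distrib_left)
    also have "\<dots> = (\<Sum>z<m. \<Sum>i<n. s i * (grover n s (?\<sigma> Y) ^^ Suc z) s i) / m"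
      by (simp add: inner_branch[OF s(1)] min_absorb2 del: funpow.simps)
    finally show ?thesis .
  qed
  ultimately show ?thesis using that by blast
qed

section \<open>Parameters of the quantum verifier and the final bounds\<close>

text \<open>With amplitudes \<open>sqrt (P i)\<close> the marked weight is at least
  \<open>\<delta>\<close>, so the averaged overlap is at most \<open>1 / (m * sqrt \<delta>)\<close>
  in modulus and its square at most 1/2. For \<open>Y = X\<close> nothing is marked and every
  iterate is \<open>s\<close>.\<close>

lemma quantum_verifier_of_distribution:
  assumes P: "\<And>i. P i \<ge> (0::real)" "(\<Sum>i<n. P i) = 1" and \<delta>: "\<delta> > 0" and m: "m \<ge> 1" "2 \<le> (real m)\<^sup>2 * \<delta>"
    and n: "n \<ge> 1"
    and bad: "\<And>Y. Y \<in> dom f \<Longrightarrow> f Y \<noteq> f X \<Longrightarrow> (\<Sum>i | i < n \<and> Y ! i \<noteq> X ! i. P i) \<ge> \<delta>"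
  obtains Q where "quantum_verifier n f X Q" "quantum_queries Q = m"
proof -
  define s where "s i = sqrt (P i)" for i
  have s: "(\<Sum>i<n. (s i)\<^sup>2) = 1" "s 0 \<ge> 0" using P by (simp_all add: s_def)
  obtain Q where Q: "wf_quantum_alg n Q" "quantum_queries Q = m"
    "\<And>Y. accept_prob n Q Y =
      ((\<Sum>z<m. \<Sum>i<n. s i * (grover n s (\<lambda>i. if Y ! i = X ! i then 1 else -1) ^^ Suc z) s i) / m)\<^sup>2"
    using grover_quantum_alg[OF s n m(1)] by blast
  have "(grover n s (\<lambda>_. 1) ^^ k) s = s" for k
    by (induction k) (simp_all add: grover_diffusion_self[OF s(1)])
  then have "accept_prob n Q X = 1"
    using s m by (simp add: Q(3) power2_eq_square del: funpow.simps)
  moreover have "1 - accept_prob n Q Y \<ge> 1 / 2" if Y: "Y \<in> dom f" "f Y \<noteq> f X" for Y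
  proof -
    let ?\<sigma> = "\<lambda>i. if Y ! i = X ! i then 1 else -1 :: real"
    let ?S = "\<Sum>z<m. \<Sum>i<n. s i * (grover n s ?\<sigma> ^^ Suc z) s i"
    define p where "p = (\<Sum>i | i < n \<and> ?\<sigma> i = -1. (s i)\<^sup>2)"
    have "p = (\<Sum>i | i < n \<and> Y ! i \<noteq> X ! i. P i)"
      using P by (auto simp: p_def s_def intro!: sum.cong)
    then have p: "p \<ge> \<delta>" "p > 0" using bad[OF Y] \<delta> by auto
    have "\<bar>?S\<bar> \<le> 1 / sqrt p"
      by (rule sum_grover_iterates_le[OF s(1) _ p_def p(2)]) auto
    then have "?S\<^sup>2 \<le> (1 / sqrt p)\<^sup>2" using power_mono[of "\<bar>?S\<bar>" "1 / sqrt p" 2] by simp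
    also have "\<dots> = 1 / p" using p by (simp add: power_divide)
    also have "\<dots> \<le> 1 / \<delta>" using p \<delta> by (intro divide_left_mono) auto
    also have "\<dots> \<le> (real m)\<^sup>2 / 2" using m \<delta> by (simp add: field_simps)
    finally have "?S\<^sup>2 / (real m)\<^sup>2 \<le> 1 / 2" using m by (simp add: field_simps del: funpow.simps)
    then show ?thesis unfolding Q(3) power_divide by linarith
  qed
  ultimately have "quantum_verifier n f X Q" using Q(1) by (simp add: quantum_verifier_def)
  then show ?thesis using Q(2) by (rule that)
qed

lemma quantum_verifier_exists:
  assumes dom: "dom f \<subseteq> {Y. length Y = n}" "X \<in> dom f" and n: "n \<ge> 1"
  obtains Q where "quantum_verifier n f X Q" "quantum_queries Q \<le> 5 * sqrt (RC n f X)"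
proof (cases "\<exists>Y\<in>dom f. f Y \<noteq> f X")
  case False
  \<comment> \<open>No input has to be rejected: staying in basis state 0 without a query is a
    verifier.\<close>
  let ?Q = "\<lparr>workspace = 1, first_unitary = 1\<^sub>m (n * 2), later_unitaries = [], accepting = {0}\<rparr>"
  have "unitary_mat (n * 2) (1\<^sub>m (n * 2))" by (rule unitary_matI) (auto simp: if_distrib cong: if_cong)
  then have "quantum_verifier n f X ?Q"
    using False n by (auto simp: quantum_verifier_def wf_quantum_alg_def accept_prob_def final_state_def)
  moreover have "RC n f X \<ge> 0" by (simp add: RC_def)
  ultimately show ?thesis using that[of ?Q] by (simp add: quantum_queries_def)
next
  case True
  then obtain Z where Z: "Z \<in> dom f" "f Z \<noteq> f X" by blast
  let ?I = "INF p \<in> {p. randomized_verifier n f X p}. SUP Y \<in> dom f. expected_queries p Y"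
  \<comment> \<open>Weights are extracted for every bound strictly above the infimum, so that no
    optimal verifier has to exist.\<close>
  have weights: "\<exists>w. (\<forall>i. w i \<ge> 0) \<and> (\<Sum>i<n. w i) \<le> R \<and>
      (\<forall>Y\<in>dom f. f Y \<noteq> f X \<longrightarrow> (\<Sum>i | i < n \<and> Y ! i \<noteq> X ! i. w i) \<ge> 1 / 2)"
    if R: "?I < ennreal R" for R
  proof -
    from R obtain p where p: "randomized_verifier n f X p"
      "(SUP Y \<in> dom f. expected_queries p Y) < ennreal R" by (auto simp: INF_less_iff)
    have "expected_queries p X \<le> ennreal R"
      using p(2) SUP_upper[OF dom(2), of "expected_queries p"] by (meson le_less_trans less_imp_le)
    from randomized_verifier_weights[OF p(1) this]
    obtain w :: "nat \<Rightarrow> real" where w: "\<And>i. w i \<ge> 0" "(\<Sum>i<n. w i) \<le> max 0 R"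
      "\<And>Y. Y \<in> dom f \<Longrightarrow> f Y \<noteq> f X \<Longrightarrow> (\<Sum>i | i < n \<and> Y ! i \<noteq> X ! i. w i) \<ge> 1 / 2" by blast
    moreover have "R \<ge> 0" using R by (cases "R \<ge> 0") (auto simp: ennreal_neg)
    ultimately show ?thesis by (intro exI[of _ w]) auto
  qed
  have total: "1 / 2 \<le> (\<Sum>i<n. w i)"
    if "\<forall>i. w i \<ge> (0::real)" "1 / 2 \<le> (\<Sum>i | i < n \<and> Z ! i \<noteq> X ! i. w i)" for w
    using that by (intro order.trans[OF _ sum_mono2[of "{..<n}" "{i. i < n \<and> Z ! i \<noteq> X ! i}" w]]) auto
  have RC: "?I = ennreal (RC n f X)"
    using RC_finite[OF dom] by (simp add: RC_def)
  \<comment> \<open>Otherwise weights of total below 1/2 would put 1/2 on the differences of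
    \<open>Z\<close>. The bound makes \<open>2 * RC n f X\<close> strictly larger than the infimum
    and later absorbs the rounding of \<open>m\<close>.\<close>
  have RC_ge: "RC n f X \<ge> 1 / 2"
  proof (rule ccontr)
    assume "\<not> RC n f X \<ge> 1 / 2"
    then obtain R where R: "RC n f X < R" "R < 1 / 2" using dense[of "RC n f X" "1 / 2"] by auto
    then have "?I < ennreal R" unfolding RC by (intro ennreal_lessI) (auto simp: RC_def intro: le_less_trans[rotated])
    from weights[OF this] obtain w where w: "\<forall>i. w i \<ge> (0::real)" "(\<Sum>i<n. w i) \<le> R"
      "1 / 2 \<le> (\<Sum>i | i < n \<and> Z ! i \<noteq> X ! i. w i)" using Z by blast
    show False using total[OF w(1,3)] w(2) R by linarith
  qed
  define R where "R = 2 * RC n f X"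
  have R1: "R \<ge> 1" using RC_ge by (simp add: R_def)
  have "?I < ennreal R" unfolding RC R_def using RC_ge by (intro ennreal_lessI) auto
  from weights[OF this] obtain w where w: "\<And>i. w i \<ge> (0::real)" "(\<Sum>i<n. w i) \<le> R"
    "\<And>Y. Y \<in> dom f \<Longrightarrow> f Y \<noteq> f X \<Longrightarrow> (\<Sum>i | i < n \<and> Y ! i \<noteq> X ! i. w i) \<ge> 1 / 2" by blast
  define W where "W = (\<Sum>i<n. w i)"
  have W: "W > 0" "W \<le> R" using total[of w] w Z by (force simp: W_def)+
  \<comment> \<open>Normalizing by \<open>W \<le> R\<close> turns the weight 1/2 into a probability
    of at least \<open>\<delta> = 1 / (2 * R)\<close>; the condition
    \<open>2 \<le> m\<^sup>2 * \<delta>\<close> then reads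
    \<open>2 * sqrt R \<le> m\<close>.\<close>
  define m where "m = nat \<lceil>2 * sqrt R\<rceil>"
  have m: "2 * sqrt R \<le> m" "real m \<le> 2 * sqrt R + 1"
    using R1 by (auto simp: m_def)
  obtain Q where Q: "quantum_verifier n f X Q" "quantum_queries Q = m"
  proof (rule quantum_verifier_of_distribution[where P = "\<lambda>i. w i / W" and \<delta> = "1 / (2 * R)" and f = f and X = X and n = n and m = m])
    show "(\<Sum>i<n. w i / W) = 1" using W by (simp add: W_def flip: sum_divide_distrib)
    have "2 \<le> 2 * sqrt R" using R1 by simp
    then show "m \<ge> 1" using m by linarith
    have "(2 * sqrt R)\<^sup>2 \<le> (real m)\<^sup>2" using m(1) R1 by (intro power_mono) auto
    then show "2 \<le> (real m)\<^sup>2 * (1 / (2 * R))" using R1 by (simp add: power_mult_distrib field_simps)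
    fix Y assume "Y \<in> dom f" "f Y \<noteq> f X"
    from w(3)[OF this] have "1 / 2 / W \<le> (\<Sum>i | i < n \<and> Y ! i \<noteq> X ! i. w i) / W"
      using W by (intro divide_right_mono) auto
    moreover have "1 / (2 * R) \<le> 1 / 2 / W" using W by (simp add: frac_le)
    ultimately show "(\<Sum>i | i < n \<and> Y ! i \<noteq> X ! i. w i / W) \<ge> 1 / (2 * R)"
      by (simp add: sum_divide_distrib)
  qed (use w W R1 n in auto)
  \<comment> \<open>Rounding up costs at most one further \<open>sqrt R\<close>.\<close>
  have "1 \<le> sqrt R" using R1 by simp
  then have "real m \<le> 3 * sqrt R" using m by linarith
  also have "\<dots> = 3 * sqrt 2 * sqrt (RC n f X)" by (simp add: R_def real_sqrt_mult)
  also have "3 * sqrt 2 \<le> (5 :: real)"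
  proof -
    have "sqrt 2 \<le> (5 / 3 :: real)" by (rule real_le_lsqrt) (auto simp: power2_eq_square)
    then show ?thesis by simp
  qed
  then have "3 * sqrt 2 * sqrt (RC n f X) \<le> 5 * sqrt (RC n f X)"
    using RC_ge by (intro mult_right_mono) auto
  finally show ?thesis using that[OF Q(1)] Q(2) by simp
qed

theorem theorem7:
  shows "\<exists>c1 c2 :: real. 0 < c1 \<and> c1 \<le> c2 \<and>
    (\<forall>(n::nat) (f :: bool list \<rightharpoonup> bool) (X :: bool list).
       n \<ge> 1 \<longrightarrow> dom f \<subseteq> {Y. length Y = n} \<longrightarrow> X \<in> dom f \<longrightarrow>
         c1 * sqrt (RC n f X) \<le> real (QC n f X) \<and> real (QC n f X) \<le> c2 * sqrt (RC n f X))"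
proof (rule exI[of _ "1 / 8"], rule exI[of _ 5], intro conjI allI impI)
  fix n :: nat and f :: "bool list \<rightharpoonup> bool" and X :: "bool list"
  assume n: "n \<ge> 1" and dom: "dom f \<subseteq> {Y. length Y = n}" "X \<in> dom f"
  obtain Q where Q: "quantum_verifier n f X Q" "quantum_queries Q \<le> 5 * sqrt (RC n f X)"
    using quantum_verifier_exists[OF dom n] by blast
  have "QC n f X \<le> quantum_queries Q"
    unfolding QC_def using Q(1) by (intro Least_le) blast
  then show "real (QC n f X) \<le> 5 * sqrt (RC n f X)" using Q(2) by linarith
  \<comment> \<open>The existence of a verifier guarantees that \<open>LEAST\<close> is
    attained.\<close>
  have "\<exists>Q. quantum_verifier n f X Q \<and> quantum_queries Q = QC n f X"
    unfolding QC_def by (rule LeastI_ex) (use Q(1) in blast)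
  then obtain Q' where Q': "quantum_verifier n f X Q'" "quantum_queries Q' = QC n f X" by blast
  have "sqrt (RC n f X) \<le> sqrt (64 * (QC n f X)\<^sup>2)"
    using RC_le_quantum_queries[OF Q'(1) n] Q'(2) by (intro real_sqrt_le_mono) simp
  also have "\<dots> = 8 * real (QC n f X)"
    by (rule real_sqrt_unique) (auto simp: power_mult_distrib)
  finally show "1 / 8 * sqrt (RC n f X) \<le> real (QC n f X)" by simp
qed auto

end
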